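(* Let $(S,U,A,C)$ be an instance of WSP with $n=|U|$, $k=|S|$, $m=|C|$. Let $u_1,\dots,u_n$ be an ordering of $U$, let $\approx$ be a plan-indistinguishability relation with respect to $C$ that has width $w$ with respect to $u_1,\dots,u_n$, and suppose there exists an encoding for $\approx$. Then $(S,U,A,C)$ can be solved in time $O^*(3^k w\log w)$.
   Context: An instance of WSP is a tuple $(S,U,A,C)$: $S$ a finite set of tasks, $U$ a finite set of users, $A(s)\subseteq U$ the authorization list of $s\in S$, $C$ a set of constraints; a constraint is a pair $(L,\Theta)$ with $L\subseteq S$ and $\Theta$ a set of functions $L\to U$. A plan is a function $\pi:T\to X$ with $T\subseteq S$, $X\subseteq U$, where $\mathrm{task}(\pi)=T$ and $\mathrm{user}(\pi)=X$ are part of the data of $\pi$ (so $X$ may contain users to which no task is assigned). $\pi$ satisfies $(L,\Theta)$ if $L\setminus T\neq\emptyset$ or $\pi|_L\in\Theta$; it is eligible if it satisfies all constraints in $C$, authorized if $\pi(s)\in A(s)$ for all $s\in T$, valid if authorized and eligible, complete if it is a plan $S\to U$. Solving WSP means outputting a valid complete plan if one exists and reporting that none exists otherwise. It is assumed each constraint and authorization can be checked in time polynomial in $n,k,m$; $O^*(h)$ means $O(q(n,k,m)h)$ for a polynomial $q$. Plans are disjoint if their task sets are disjoint and their user sets are disjoint; the union $\pi_1\cup\pi_2$ of disjoint plans has the union task and user sets and agrees with each $\pi_i$ on $\mathrm{task}(\pi_i)$. Eligible plans $\pi_1,\pi_2$ are extension-equivalent if they have the same user set and task set and for every plan $\pi'$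 disjoint from both, $\pi_1\cup\pi'$ is eligible iff $\pi_2\cup\pi'$ is. A plan-indistinguishability relation with respect to $C$ is an equivalence relation $\approx$ on eligible plans refining extension-equivalence such that if $\pi_1\approx\pi_2$ are eligible and $\pi'$ is disjoint from both with $\pi_1\cup\pi'$ eligible, then $\pi_1\cup\pi'\approx\pi_2\cup\pi'$. For $X\subseteq U$, $T\subseteq S$, $\Pi[X,T]$ denotes the set of eligible plans with user set $X$ and task set $T$. With $U_i=\{u_1,\dots,u_i\}$, the width of $\approx$ with respect to $u_1,\dots,u_n$ is the maximum over $i\in[n]$ and $T\subseteq S$ of the number of $\approx$-equivalence classes meeting $\Pi[U_i,T]$. An encoding for $\approx$ is a function $\mathrm{enc}$ from the set of all plans to some set $P$ such that, with $P[X,T]=\mathrm{enc}(\Pi[X,T])$, for all $X,T$ and $\pi_1,\pi_2\in\Pi[X,T]$: (1) $\mathrm{enc}(\pi_1)=\mathrm{enc}(\pi_2)$ iff $\pi_1\approx\pi_2$; (2) $\mathrm{enc}(\pi_1)$ is computable in time polynomial in $n,k,m$; (3) there is a linear order on $P[X,T]$ whose comparisons are decidable in time polynomial in $n,k,m$.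
   Formalization: In the time bound w log w is read with max(2,w) in place of w, since for w ≤ 1 the literal bound would be 0 (for example with no constraints and width 1); the width is taken to be 0 when there are no users. *)

theory Defs
  imports Complex_Main
begin

section \<open>The workflow satisfiability problem\<close>

type_synonym ('s, 'u) wsp_constraint = "'s set \<times> ('s \<rightharpoonup> 'u) set"

text \<open>A plan is stored as its user set (which may contain users without a task) and a partial
  map whose domain is its task set.\<close>

type_synonym ('s, 'u) plan = "'u set \<times> ('s \<rightharpoonup> 'u)"

abbreviation users :: "('s, 'u) plan \<Rightarrow> 'u set" where
  "users \<pi> \<equiv> fst \<pi>"

abbreviation tasks :: "('s, 'u) plan \<Rightarrow> 's set" where
  "tasks \<pi> \<equiv> dom (snd \<pi>)"

definition wsp_instance ::
  "'s set \<Rightarrow> 'u set \<Rightarrow> ('s \<Rightarrow> 'u set) \<Rightarrow> ('s, 'u) wsp_constraint set \<Rightarrow> bool" where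
  "wsp_instance S U A C \<longleftrightarrow>
     finite S \<and> finite U \<and> (\<forall>s\<in>S. A s \<subseteq> U) \<and>
     (\<forall>(L, \<Theta>)\<in>C. L \<subseteq> S \<and> (\<forall>\<theta>\<in>\<Theta>. dom \<theta> = L \<and> ran \<theta> \<subseteq> U))"

definition is_plan :: "'s set \<Rightarrow> 'u set \<Rightarrow> ('s, 'u) plan \<Rightarrow> bool" where
  "is_plan S U \<pi> \<longleftrightarrow> tasks \<pi> \<subseteq> S \<and> users \<pi> \<subseteq> U \<and> ran (snd \<pi>) \<subseteq> users \<pi>"

definition satisfies :: "('s, 'u) plan \<Rightarrow> ('s, 'u) wsp_constraint \<Rightarrow> bool" where
  "satisfies \<pi> c \<longleftrightarrow> fst c - tasks \<pi> \<noteq> {} \<or> snd \<pi> |` fst c \<in> snd c"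

definition eligible ::
  "'s set \<Rightarrow> 'u set \<Rightarrow> ('s, 'u) wsp_constraint set \<Rightarrow> ('s, 'u) plan \<Rightarrow> bool" where
  "eligible S U C \<pi> \<longleftrightarrow> is_plan S U \<pi> \<and> (\<forall>c\<in>C. satisfies \<pi> c)"

definition authorized :: "('s \<Rightarrow> 'u set) \<Rightarrow> ('s, 'u) plan \<Rightarrow> bool" where
  "authorized A \<pi> \<longleftrightarrow> (\<forall>s\<in>tasks \<pi>. the (snd \<pi> s) \<in> A s)"

definition valid ::
  "'s set \<Rightarrow> 'u set \<Rightarrow> ('s \<Rightarrow> 'u set) \<Rightarrow> ('s, 'u) wsp_constraint set \<Rightarrow> ('s, 'u) plan \<Rightarrow> bool" where
  "valid S U A C \<pi> \<longleftrightarrow> authorized A \<pi> \<and> eligible S U C \<pi>"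

definition complete_plan :: "'s set \<Rightarrow> 'u set \<Rightarrow> ('s, 'u) plan \<Rightarrow> bool" where
  "complete_plan S U \<pi> \<longleftrightarrow> is_plan S U \<pi> \<and> tasks \<pi> = S \<and> users \<pi> = U"

definition disjoint_plans :: "('s, 'u) plan \<Rightarrow> ('s, 'u) plan \<Rightarrow> bool" where
  "disjoint_plans \<pi>\<^sub>1 \<pi>\<^sub>2 \<longleftrightarrow> tasks \<pi>\<^sub>1 \<inter> tasks \<pi>\<^sub>2 = {} \<and> users \<pi>\<^sub>1 \<inter> users \<pi>\<^sub>2 = {}"

definition plan_union :: "('s, 'u) plan \<Rightarrow> ('s, 'u) plan \<Rightarrow> ('s, 'u) plan" where
  "plan_union \<pi>\<^sub>1 \<pi>\<^sub>2 = (users \<pi>\<^sub>1 \<union> users \<pi>\<^sub>2, snd \<pi>\<^sub>1 ++ snd \<pi>\<^sub>2)"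

definition ext_equiv ::
  "'s set \<Rightarrow> 'u set \<Rightarrow> ('s, 'u) wsp_constraint set \<Rightarrow> (('s, 'u) plan \<times> ('s, 'u) plan) set" where
  "ext_equiv S U C =
     {(\<pi>\<^sub>1, \<pi>\<^sub>2). eligible S U C \<pi>\<^sub>1 \<and> eligible S U C \<pi>\<^sub>2 \<and>
        users \<pi>\<^sub>1 = users \<pi>\<^sub>2 \<and> tasks \<pi>\<^sub>1 = tasks \<pi>\<^sub>2 \<and>
        (\<forall>\<pi>'. is_plan S U \<pi>' \<and> disjoint_plans \<pi>\<^sub>1 \<pi>' \<and> disjoint_plans \<pi>\<^sub>2 \<pi>' \<longrightarrow>
           (eligible S U C (plan_union \<pi>\<^sub>1 \<pi>') \<longleftrightarrow> eligible S U C (plan_union \<pi>\<^sub>2 \<pi>')))}"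

definition plan_indistinguishability ::
  "'s set \<Rightarrow> 'u set \<Rightarrow> ('s, 'u) wsp_constraint set \<Rightarrow>
   (('s, 'u) plan \<times> ('s, 'u) plan) set \<Rightarrow> bool" where
  "plan_indistinguishability S U C R \<longleftrightarrow>
     equiv {\<pi>. eligible S U C \<pi>} R \<and> R \<subseteq> ext_equiv S U C \<and>
     (\<forall>\<pi>\<^sub>1 \<pi>\<^sub>2 \<pi>'. (\<pi>\<^sub>1, \<pi>\<^sub>2) \<in> R \<and> is_plan S U \<pi>' \<and>
        disjoint_plans \<pi>\<^sub>1 \<pi>' \<and> disjoint_plans \<pi>\<^sub>2 \<pi>' \<and> eligible S U C (plan_union \<pi>\<^sub>1 \<pi>') \<longrightarrow>
        (plan_union \<pi>\<^sub>1 \<pi>', plan_union \<pi>\<^sub>2 \<pi>') \<in> R)"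

definition eligible_plans ::
  "'s set \<Rightarrow> 'u set \<Rightarrow> ('s, 'u) wsp_constraint set \<Rightarrow> 'u set \<Rightarrow> 's set \<Rightarrow> ('s, 'u) plan set" where
  "eligible_plans S U C X T = {\<pi>. eligible S U C \<pi> \<and> users \<pi> = X \<and> tasks \<pi> = T}"

text \<open>The inserted 0 only matters when there are no users: then the maximum ranges over the empty
  set.\<close>

definition width ::
  "'s set \<Rightarrow> 'u list \<Rightarrow> ('s, 'u) wsp_constraint set \<Rightarrow>
   (('s, 'u) plan \<times> ('s, 'u) plan) set \<Rightarrow> nat" where
  "width S us C R = Max (insert 0
     {card {c \<in> {\<pi>. eligible S (set us) C \<pi>} // R.
              c \<inter> eligible_plans S (set us) C (set (take i us)) T \<noteq> {}} | i T.
        i \<in> {1..length us} \<and> T \<subseteq> S})"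

definition enumerates :: "'a list \<Rightarrow> 'a set \<Rightarrow> bool" where
  "enumerates xs X \<longleftrightarrow> distinct xs \<and> set xs = X"


section \<open>Model of computation\<close>

text \<open>Programs are written in a strict first-order functional language over binary trees (in the
  style of Jones's language F). Trees are immutable and shared, so every evaluation step is a
  constant number of pointer operations, and the running time is the number of steps.
  A program is a list of function bodies; each function has one argument, \<open>Var i\<close> refers to the
  \<open>i\<close>-th innermost bound value, and \<open>Call f\<close> calls the \<open>f\<close>-th function.\<close>

datatype tree = Leaf | Node tree tree

datatype expr =
    Var nat
  | Empty
  | Pair expr expr
  | Left expr
  | Right expr
  | Cond expr expr expr
  | Bind expr expr
  | Call nat expr

type_synonym program = "expr list"

fun left :: "tree \<Rightarrow> tree" where
  "left Leaf = Leaf"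
| "left (Node a b) = a"

fun right :: "tree \<Rightarrow> tree" where
  "right Leaf = Leaf"
| "right (Node a b) = b"

inductive eval :: "program \<Rightarrow> tree list \<Rightarrow> expr \<Rightarrow> tree \<Rightarrow> nat \<Rightarrow> bool" for P where
  Var: "i < length \<rho> \<Longrightarrow> eval P \<rho> (Var i) (\<rho> ! i) 1"
| Empty: "eval P \<rho> Empty Leaf 1"
| Pair: "eval P \<rho> a v s \<Longrightarrow> eval P \<rho> b w t \<Longrightarrow> eval P \<rho> (Pair a b) (Node v w) (s + t + 1)"
| Left: "eval P \<rho> a v t \<Longrightarrow> eval P \<rho> (Left a) (left v) (t + 1)"
| Right: "eval P \<rho> a v t \<Longrightarrow> eval P \<rho> (Right a) (right v) (t + 1)"
| Cond_Node: "eval P \<rho> c (Node x y) s \<Longrightarrow> eval P \<rho> a v t \<Longrightarrow> eval P \<rho> (Cond c a b) v (s + t + 1)"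
| Cond_Leaf: "eval P \<rho> c Leaf s \<Longrightarrow> eval P \<rho> b v t \<Longrightarrow> eval P \<rho> (Cond c a b) v (s + t + 1)"
| Bind: "eval P \<rho> a v s \<Longrightarrow> eval P (v # \<rho>) b w t \<Longrightarrow> eval P \<rho> (Bind a b) w (s + t + 1)"
| Call: "eval P \<rho> a v s \<Longrightarrow> f < length P \<Longrightarrow> eval P [v] (P ! f) w t \<Longrightarrow>
    eval P \<rho> (Call f a) w (s + t + 1)"

lemma eval_deterministic:
  "eval P \<rho> e v t \<Longrightarrow> eval P \<rho> e v' t' \<Longrightarrow> v' = v \<and> t' = t"
proof (induction arbitrary: v' t' rule: eval.induct)
  case (Var i \<rho>)
  then show ?case by (auto elim: eval.cases)
next
  case (Empty \<rho>)
  then show ?case by (auto elim: eval.cases)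
next
  case (Pair \<rho> a v s b w t)
  from Pair.prems show ?case by cases (auto dest: Pair.IH)
next
  case (Left \<rho> a v t)
  from Left.prems show ?case by cases (auto dest: Left.IH)
next
  case (Right \<rho> a v t)
  from Right.prems show ?case by cases (auto dest: Right.IH)
next
  case (Cond_Node \<rho> c x y s a v t b)
  from Cond_Node.prems show ?case by cases (auto dest: Cond_Node.IH)
next
  case (Cond_Leaf \<rho> c s b v t a)
  from Cond_Leaf.prems show ?case by cases (auto dest: Cond_Leaf.IH)
next
  case (Bind \<rho> a v s b w t)
  from Bind.prems show ?case by cases (use Bind.IH in blast)
next
  case (Call \<rho> a v s f w t)
  from Call.prems show ?case by cases (use Call.IH in blast)
qed

definition runs :: "program \<Rightarrow> nat \<Rightarrow> tree \<Rightarrow> tree \<Rightarrow> nat \<Rightarrow> bool" where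
  "runs P f x v t \<longleftrightarrow> f < length P \<and> eval P [x] (P ! f) v t"

definition computes_within :: "program \<Rightarrow> nat \<Rightarrow> tree \<Rightarrow> tree \<Rightarrow> nat \<Rightarrow> bool" where
  "computes_within P f x v B \<longleftrightarrow> (\<exists>t\<le>B. runs P f x v t)"

text \<open>Polynomials in three variables with natural number coefficients.\<close>

inductive polynomial3 :: "(nat \<Rightarrow> nat \<Rightarrow> nat \<Rightarrow> nat) \<Rightarrow> bool" where
  "polynomial3 (\<lambda>n k m. c)"
| "polynomial3 (\<lambda>n k m. n)"
| "polynomial3 (\<lambda>n k m. k)"
| "polynomial3 (\<lambda>n k m. m)"
| "polynomial3 p \<Longrightarrow> polynomial3 q \<Longrightarrow> polynomial3 (\<lambda>n k m. p n k m + q n k m)"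
| "polynomial3 p \<Longrightarrow> polynomial3 q \<Longrightarrow> polynomial3 (\<lambda>n k m. p n k m * q n k m)"


section \<open>Representation of instances and plans as trees\<close>

fun list_tree :: "tree list \<Rightarrow> tree" where
  "list_tree [] = Leaf"
| "list_tree (x # xs) = Node x (list_tree xs)"

definition num_tree :: "nat \<Rightarrow> tree" where
  "num_tree i = list_tree (replicate i Leaf)"

definition bool_tree :: "bool \<Rightarrow> tree" where
  "bool_tree b = (if b then Node Leaf Leaf else Leaf)"

definition set_tree :: "'a list \<Rightarrow> 'a set \<Rightarrow> tree" where
  "set_tree xs X = list_tree (map (\<lambda>x. bool_tree (x \<in> X)) xs)"

text \<open>Tasks, users and constraints are named by their positions in the enumerations \<open>ss\<close>, \<open>us\<close>
  and \<open>cs\<close>. A plan is represented by its user set and the table of its values along \<open>ss\<close>.\<close>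

definition user_tree :: "'u list \<Rightarrow> 'u \<Rightarrow> tree" where
  "user_tree us u = num_tree (LEAST j. j < length us \<and> us ! j = u)"

definition plan_tree :: "'s list \<Rightarrow> 'u list \<Rightarrow> ('s, 'u) plan \<Rightarrow> tree" where
  "plan_tree ss us \<pi> = Node (set_tree us (users \<pi>))
     (list_tree (map (\<lambda>s. case snd \<pi> s of None \<Rightarrow> Leaf | Some u \<Rightarrow> Node Leaf (user_tree us u)) ss))"

text \<open>The tree \<open>D\<close> is a description of the instance, in any format: it is only accessed through the
  procedures \<open>fa\<close> (authorization check), \<open>fc\<close> (constraint check), \<open>fe\<close> (encoding) and \<open>fo\<close>
  (comparison of codes) of the program \<open>P\<close>, and \<open>B\<close> bounds the running time of each such call.\<close>

definition checkable_within ::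
  "program \<Rightarrow> nat \<Rightarrow> nat \<Rightarrow> nat \<Rightarrow> tree \<Rightarrow> 's list \<Rightarrow> 'u list \<Rightarrow> ('s, 'u) wsp_constraint list \<Rightarrow>
   ('s \<Rightarrow> 'u set) \<Rightarrow> bool" where
  "checkable_within P fa fc B D ss us cs A \<longleftrightarrow>
     (\<forall>i<length ss. \<forall>j<length us.
        computes_within P fa (Node D (Node (num_tree i) (num_tree j)))
          (bool_tree (us ! j \<in> A (ss ! i))) B) \<and>
     (\<forall>j<length cs. \<forall>\<pi>. is_plan (set ss) (set us) \<pi> \<longrightarrow>
        computes_within P fc (Node D (Node (num_tree j) (plan_tree ss us \<pi>)))
          (bool_tree (satisfies \<pi> (cs ! j))) B)"

text \<open>Codes are trees, since they are results of computations. The linear order on the codes of the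
  plans with user set \<open>X\<close> and task set \<open>T\<close> may depend on \<open>X\<close> and \<open>T\<close>, so these are passed to the
  comparison procedure.\<close>

definition encoding_within ::
  "program \<Rightarrow> nat \<Rightarrow> nat \<Rightarrow> nat \<Rightarrow> tree \<Rightarrow> 's list \<Rightarrow> 'u list \<Rightarrow> ('s, 'u) wsp_constraint set \<Rightarrow>
   (('s, 'u) plan \<times> ('s, 'u) plan) set \<Rightarrow> (('s, 'u) plan \<Rightarrow> tree) \<Rightarrow> bool" where
  "encoding_within P fe fo B D ss us C R enc \<longleftrightarrow>
     (\<forall>X T. X \<subseteq> set us \<and> T \<subseteq> set ss \<longrightarrow>
        (let \<Pi> = eligible_plans (set ss) (set us) C X T in
           (\<forall>\<pi>\<^sub>1\<in>\<Pi>. \<forall>\<pi>\<^sub>2\<in>\<Pi>. enc \<pi>\<^sub>1 = enc \<pi>\<^sub>2 \<longleftrightarrow> (\<pi>\<^sub>1, \<pi>\<^sub>2) \<in> R) \<and>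
           (\<forall>\<pi>\<in>\<Pi>. computes_within P fe (Node D (plan_tree ss us \<pi>)) (enc \<pi>) B) \<and>
           (\<exists>r. linear_order_on (enc ` \<Pi>) r \<and>
              (\<forall>a\<in>enc ` \<Pi>. \<forall>b\<in>enc ` \<Pi>.
                 computes_within P fo
                   (Node D (Node (set_tree us X) (Node (set_tree ss T) (Node a b))))
                   (bool_tree ((a, b) \<in> r)) B))))"

definition instance_tree ::
  "tree \<Rightarrow> 's list \<Rightarrow> 'u list \<Rightarrow> ('s, 'u) wsp_constraint list \<Rightarrow> tree" where
  "instance_tree D ss us cs =
     Node D (Node (num_tree (length us)) (Node (num_tree (length ss)) (num_tree (length cs))))"

definition wsp_answer ::
  "'s list \<Rightarrow> 'u list \<Rightarrow> ('s \<Rightarrow> 'u set) \<Rightarrow> ('s, 'u) wsp_constraint set \<Rightarrow> tree \<Rightarrow> bool" where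
  "wsp_answer ss us A C v \<longleftrightarrow>
     (if \<exists>\<pi>. complete_plan (set ss) (set us) \<pi> \<and> valid (set ss) (set us) A C \<pi>
      then \<exists>\<pi>. complete_plan (set ss) (set us) \<pi> \<and> valid (set ss) (set us) A C \<pi> \<and>
             v = Node Leaf (plan_tree ss us \<pi>)
      else v = Leaf)"

end

theory Submission
  imports Defs "HOL-Library.List_Lexorder"
begin

text \<open>
  Process the users in the order \<open>u\<^sub>1, \<dots>, u\<^sub>n\<close>. After \<open>i\<close> users keep a list of valid plans with user set
  \<open>U\<^sub>i\<close>, one from each equivalence class containing a valid plan. For the next user, extend every plan
  by assigning \<open>u\<^sub>i\<^sub>+\<^sub>1\<close> to every subset of its free tasks, discard the invalid results and keep one
  candidate from each class. Since equivalent plans have equivalent extensions, nothing is lost by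
  replacing a plan by its representative. There are at most \<open>w\<close> plans for each task set \<open>T\<close>, each with
  \<open>2 ^ (k - |T|)\<close> extensions, so a level has at most \<open>w * 3 ^ k\<close> candidates. One representative for each
  class is selected by a merge sort that drops duplicates, ordering plans lexicographically by task
  set and then by code. A level has at most \<open>2 ^ (n * k)\<close> candidates, so polynomial recursion depth
  suffices.
\<close>

section \<open>Symbolic execution\<close>

text \<open>\<open>R\<close> respects eligibility but not authorization, so a class may mix
  authorized and unauthorized plans. Discarding invalid plans at once is harmless because
  authorization is a condition on single tasks: it passes to restrictions and to disjoint unions.
  The steps have to be counted for a concrete program in a language without arithmetic. Lengths are
  therefore never computed: each level carries a unary depth that grows by \<open>k\<close> from
  user to user, and the sort splits by powers of two. The depth of the sort, at most
  \<open>n * k\<close>, is charged to the polynomial and the number of candidates to the table size;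
  the logarithm of the bound enters only at the end, as a factor that is at least 1. Every routine
  is specified by a function on lists together with a bound on its steps, so that counting and
  correctness can be argued on lists.\<close>

definition wp :: "program \<Rightarrow> tree list \<Rightarrow> expr \<Rightarrow> (tree \<Rightarrow> nat \<Rightarrow> bool) \<Rightarrow> bool" where
  "wp P \<rho> e K \<longleftrightarrow> (\<exists>v t. eval P \<rho> e v t \<and> K v t)"

definition wp_call :: "program \<Rightarrow> nat \<Rightarrow> tree \<Rightarrow> (tree \<Rightarrow> nat \<Rightarrow> bool) \<Rightarrow> bool" where
  "wp_call P f x K \<longleftrightarrow> (\<exists>v t. runs P f x v t \<and> K v t)"

inductive_cases eval_VarE: "eval P \<rho> (Var i) v t"
inductive_cases eval_EmptyE: "eval P \<rho> Empty v t"
inductive_cases eval_PairE: "eval P \<rho> (Pair a b) v t"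
inductive_cases eval_LeftE: "eval P \<rho> (Left a) v t"
inductive_cases eval_RightE: "eval P \<rho> (Right a) v t"
inductive_cases eval_CondE: "eval P \<rho> (Cond c a b) v t"
inductive_cases eval_BindE: "eval P \<rho> (Bind a b) v t"
inductive_cases eval_CallE: "eval P \<rho> (Call f a) v t"

text \<open>Used from left to right, these equivalences make the simplifier an interpreter: each
  constructor hands its value and the accumulated step count to the continuation.\<close>

lemma wp_Var [simp]: "wp P \<rho> (Var i) K \<longleftrightarrow> i < length \<rho> \<and> K (\<rho> ! i) 1"
  unfolding wp_def by (fastforce elim!: eval_VarE intro: eval.Var)

lemma wp_Empty [simp]: "wp P \<rho> Empty K \<longleftrightarrow> K Leaf 1"
  unfolding wp_def by (fastforce elim!: eval_EmptyE intro: eval.Empty)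

lemma wp_Pair [simp]:
  "wp P \<rho> (Pair a b) K \<longleftrightarrow> wp P \<rho> a (\<lambda>v s. wp P \<rho> b (\<lambda>w t. K (Node v w) (s + t + 1)))"
  unfolding wp_def by (fastforce elim!: eval_PairE intro: eval.Pair)

lemma wp_Left [simp]: "wp P \<rho> (Left a) K \<longleftrightarrow> wp P \<rho> a (\<lambda>v t. K (left v) (t + 1))"
  unfolding wp_def by (fastforce elim!: eval_LeftE intro: eval.Left)

lemma wp_Right [simp]: "wp P \<rho> (Right a) K \<longleftrightarrow> wp P \<rho> a (\<lambda>v t. K (right v) (t + 1))"
  unfolding wp_def by (fastforce elim!: eval_RightE intro: eval.Right)

lemma wp_Cond [simp]:
  "wp P \<rho> (Cond c a b) K \<longleftrightarrow>
     wp P \<rho> c (\<lambda>x s. wp P \<rho> (if x = Leaf then b else a) (\<lambda>v t. K v (s + t + 1)))"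
proof
  assume "wp P \<rho> (Cond c a b) K"
  then show "wp P \<rho> c (\<lambda>x s. wp P \<rho> (if x = Leaf then b else a) (\<lambda>v t. K v (s + t + 1)))"
    unfolding wp_def by (fastforce elim!: eval_CondE)
next
  assume "wp P \<rho> c (\<lambda>x s. wp P \<rho> (if x = Leaf then b else a) (\<lambda>v t. K v (s + t + 1)))"
  then obtain x s v t where "eval P \<rho> c x s" "eval P \<rho> (if x = Leaf then b else a) v t"
    "K v (s + t + 1)"
    unfolding wp_def by blast
  then show "wp P \<rho> (Cond c a b) K"
    unfolding wp_def
    by (cases x) (fastforce dest: eval.Cond_Leaf eval.Cond_Node)+
qed

lemma wp_Bind [simp]:
  "wp P \<rho> (Bind a b) K \<longleftrightarrow> wp P \<rho> a (\<lambda>v s. wp P (v # \<rho>) b (\<lambda>w t. K w (s + t + 1)))"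
  unfolding wp_def by (fastforce elim!: eval_BindE intro: eval.Bind)

lemma wp_Call [simp]:
  "wp P \<rho> (Call f a) K \<longleftrightarrow> wp P \<rho> a (\<lambda>v s. wp_call P f v (\<lambda>w t. K w (s + t + 1)))"
  unfolding wp_def wp_call_def runs_def by (fastforce elim!: eval_CallE intro: eval.Call)

text \<open>Continuations must stay untouched until the value passed to them is known.\<close>

lemma wp_weak_cong [cong]: "e = e' \<Longrightarrow> wp P \<rho> e K \<longleftrightarrow> wp P \<rho> e' K"
  by simp

lemma wp_call_weak_cong [cong]: "x = x' \<Longrightarrow> wp_call P f x K \<longleftrightarrow> wp_call P f x' K"
  by simp

lemma computes_within_wp:
  "computes_within P f x v B \<longleftrightarrow> wp_call P f x (\<lambda>v' t. v' = v \<and> t \<le> B)"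
  unfolding computes_within_def wp_call_def by auto

definition cost :: "program \<Rightarrow> nat \<Rightarrow> tree \<Rightarrow> nat" where
  "cost P f x = (THE t. \<exists>v. runs P f x v t)"

text \<open>Turns a proved specification into a rewrite rule for calls. Determinism makes the step
  count unique, so it can be named by the opaque constant \<open>cost\<close>, about which
  arithmetic needs only the upper bound.\<close>

lemma computes_withinD:
  assumes "computes_within P f x v B"
  shows "wp_call P f x K \<longleftrightarrow> K v (cost P f x)" "cost P f x \<le> B"
proof -
  from assms obtain t where t: "t \<le> B" "runs P f x v t"
    unfolding computes_within_def by blast
  have unique: "v' = v \<and> t' = t" if "runs P f x v' t'" for v' t'
    using that t(2) unfolding runs_def by (metis eval_deterministic)
  then have "cost P f x = t"
    unfolding cost_def using t(2) by blast
  with t unique show "wp_call P f x K \<longleftrightarrow> K v (cost P f x)" "cost P f x \<le> B"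
    unfolding wp_call_def by blast+
qed

lemma computes_within_mono: "computes_within P f x v B \<Longrightarrow> B \<le> B' \<Longrightarrow> computes_within P f x v B'"
  unfolding computes_within_def by (meson le_trans)

text \<open>Appending leaves all earlier indices in place, so calls inside the given library resolve
  as before once the solver is put behind it.\<close>

lemma eval_append: "eval P \<rho> e v t \<Longrightarrow> eval (P @ Q) \<rho> e v t"
proof (induction rule: eval.induct)
  case (Call \<rho> a v s f w t)
  then show ?case by (intro eval.Call) (auto simp: nth_append)
qed (blast intro: eval.intros)+

lemma computes_within_append:
  "computes_within P f x v B \<Longrightarrow> computes_within (P @ Q) f x v B"
  unfolding computes_within_def runs_def by (auto simp: nth_append dest: eval_append)

lemma bool_tree_eq_Leaf [simp]: "bool_tree b = Leaf \<longleftrightarrow> \<not> b"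
  by (simp add: bool_tree_def)

lemma num_tree_0 [simp]: "num_tree 0 = Leaf"
  by (simp add: num_tree_def)

lemma num_tree_Suc [simp]: "num_tree (Suc i) = Node Leaf (num_tree i)"
  by (simp add: num_tree_def)


section \<open>The program\<close>

text \<open>Names instead of numbers let the bodies call each other through a parameter
  \<open>ix\<close>, before their position behind a library of unknown length is fixed.\<close>

datatype routine =
    Append | Prefix | Authorized | Constraints | Check | Conses | Extend | Filter_Valid | Candidates
  | Support | Less | Le | Merge | Sort | Loop | Full | Find | Main

fun position :: "routine \<Rightarrow> nat" where
  "position Append = 0"
| "position Prefix = 1"
| "position Authorized = 2"
| "position Constraints = 3"
| "position Check = 4"
| "position Conses = 5"
| "position Extend = 6"
| "position Filter_Valid = 7"
| "position Candidates = 8"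
| "position Support = 9"
| "position Less = 10"
| "position Le = 11"
| "position Merge = 12"
| "position Sort = 13"
| "position Loop = 14"
| "position Full = 15"
| "position Find = 16"
| "position Main = 17"

definition routines :: "routine list" where
  "routines = [Append, Prefix, Authorized, Constraints, Check, Conses, Extend, Filter_Valid,
     Candidates, Support, Less, Le, Merge, Sort, Loop, Full, Find, Main]"

lemma nth_routines: "position r < length routines" "routines ! position r = r"
  by (cases r; simp add: routines_def)+

abbreviation (input) "arg \<equiv> Var 0"
abbreviation (input) "truth \<equiv> Pair Empty Empty"

text \<open>
  Argument formats, where \<open>I\<close> is the instance tree, \<open>D\<close> its first component, \<open>X\<close> a user set, and a row is
  the table of values of a plan along the tasks:
  \<open>Prefix (n, i)\<close> is the set of the first \<open>i\<close> of \<open>n\<close> users;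
  \<open>Authorized (D, i, row)\<close> checks a row whose first task has number \<open>i\<close>;
  \<open>Constraints (D, j, plan)\<close> checks the first \<open>j\<close> constraints;
  \<open>Extend (e, row)\<close> lists the rows obtained by overwriting free entries with \<open>e\<close>;
  \<open>Filter_Valid ((I, X), rows, out)\<close> and \<open>Candidates ((I, X), e, plans)\<close> return plans with user set \<open>X\<close>;
  \<open>Sort (D, d, plans)\<close> sorts the first \<open>2 ^ d\<close> plans and also returns the remaining ones;
  \<open>Loop (I, r, i, d, plans)\<close> processes the last \<open>r\<close> users, the first \<open>i\<close> being done.
\<close>

fun body :: "(routine \<Rightarrow> nat) \<Rightarrow> nat \<Rightarrow> nat \<Rightarrow> nat \<Rightarrow> nat \<Rightarrow> routine \<Rightarrow> expr" where
  "body ix fa fc fe fo Append =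
     Cond (Left arg)
       (Pair (Left (Left arg)) (Call (ix Append) (Pair (Right (Left arg)) (Right arg))))
       (Right arg)"
| "body ix fa fc fe fo Prefix =
     Cond (Left arg)
       (Pair (Cond (Right arg) truth Empty)
          (Call (ix Prefix) (Pair (Right (Left arg)) (Right (Right arg)))))
       Empty"
| "body ix fa fc fe fo Authorized =
     Cond (Right (Right arg))
       (Cond
          (Cond (Left (Right (Right arg)))
             (Call fa (Pair (Left arg) (Pair (Left (Right arg)) (Right (Left (Right (Right arg)))))))
             truth)
          (Call (ix Authorized)
             (Pair (Left arg) (Pair (Pair Empty (Left (Right arg))) (Right (Right (Right arg))))))
          Empty)
       truth"
| "body ix fa fc fe fo Constraints =
     Cond (Left (Right arg))
       (Bind (Pair (Left arg) (Pair (Right (Left (Right arg))) (Right (Right arg))))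
          (Cond (Call fc arg) (Call (ix Constraints) arg) Empty))
       truth"
| "body ix fa fc fe fo Check =
     Cond (Call (ix Authorized) (Pair (Left (Left arg)) (Pair Empty (Right (Right arg)))))
       (Call (ix Constraints)
          (Pair (Left (Left arg)) (Pair (Right (Right (Right (Left arg)))) (Right arg))))
       Empty"
| "body ix fa fc fe fo Conses =
     Cond (Left (Right arg))
       (Pair (Pair (Left arg) (Left (Left (Right arg))))
          (Call (ix Conses)
             (Pair (Left arg) (Pair (Right (Left (Right arg))) (Right (Right arg))))))
       (Right (Right arg))"
| "body ix fa fc fe fo Extend =
     Cond (Right arg)
       (Bind (Call (ix Extend) (Pair (Left arg) (Right (Right arg))))
          (Cond (Left (Right (Var 1)))
             (Call (ix Conses) (Pair (Left (Right (Var 1))) (Pair (Var 0) Empty)))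
             (Call (ix Conses) (Pair Empty (Pair (Var 0)
                (Call (ix Conses) (Pair (Left (Var 1)) (Pair (Var 0) Empty))))))))
       truth"
| "body ix fa fc fe fo Filter_Valid =
     Cond (Left (Right arg))
       (Bind (Call (ix Filter_Valid)
            (Pair (Left arg) (Pair (Right (Left (Right arg))) (Right (Right arg)))))
          (Bind (Pair (Right (Left (Var 1))) (Left (Left (Right (Var 1)))))
            (Cond (Call (ix Check) (Pair (Left (Left (Var 2))) (Var 0)))
               (Pair (Var 0) (Var 1))
               (Var 1))))
       (Right (Right arg))"
| "body ix fa fc fe fo Candidates =
     Cond (Right (Right arg))
       (Call (ix Filter_Valid) (Pair (Left arg)
          (Pair (Call (ix Extend) (Pair (Left (Right arg)) (Right (Left (Right (Right arg))))))
             (Call (ix Candidates)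
                (Pair (Left arg) (Pair (Left (Right arg)) (Right (Right (Right arg)))))))))
       Empty"
| "body ix fa fc fe fo Support =
     Cond arg (Pair (Cond (Left arg) truth Empty) (Call (ix Support) (Right arg))) Empty"
| "body ix fa fc fe fo Less =
     Cond (Left arg)
       (Bind (Pair (Right (Left arg)) (Right (Right arg)))
          (Cond (Left (Left (Var 1)))
             (Cond (Left (Right (Var 1))) (Call (ix Less) (Var 0)) Empty)
             (Cond (Left (Right (Var 1))) truth (Call (ix Less) (Var 0)))))
       Empty"
| "body ix fa fc fe fo Le =
     Bind (Left (Right arg)) (Bind (Right (Right (Var 1)))
       (Cond (Call (ix Less) (Pair (Right (Var 1)) (Right (Var 0))))
          truth
          (Cond (Call (ix Less) (Pair (Right (Var 0)) (Right (Var 1))))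
             Empty
             (Call fo (Pair (Left (Var 2)) (Pair (Left (Var 1))
                (Pair (Call (ix Support) (Right (Var 1)))
                   (Pair (Call fe (Pair (Left (Var 2)) (Var 1)))
                      (Call fe (Pair (Left (Var 2)) (Var 0)))))))))))"
| "body ix fa fc fe fo Merge =
     Cond (Left (Right arg))
       (Cond (Right (Right arg))
          (Bind (Left (Left (Right arg))) (Bind (Left (Right (Right (Var 1))))
             (Cond (Call (ix Le) (Pair (Left (Var 2)) (Pair (Var 1) (Var 0))))
                (Bind (Call (ix Merge) (Pair (Left (Var 2))
                     (Pair (Right (Left (Right (Var 2)))) (Right (Right (Var 2))))))
                   (Cond (Call (ix Le) (Pair (Left (Var 3)) (Pair (Var 1) (Var 2))))
                      (Var 0)
                      (Pair (Var 2) (Var 0))))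
                (Pair (Var 0) (Call (ix Merge) (Pair (Left (Var 2))
                     (Pair (Left (Right (Var 2))) (Right (Right (Right (Var 2)))))))))))
          (Left (Right arg)))
       (Right (Right arg))"
| "body ix fa fc fe fo Sort =
     Cond (Right (Right arg))
       (Cond (Left (Right arg))
          (Bind (Call (ix Sort) (Pair (Left arg)
               (Pair (Right (Left (Right arg))) (Right (Right arg)))))
             (Bind (Call (ix Sort) (Pair (Left (Var 1))
                  (Pair (Right (Left (Right (Var 1)))) (Right (Var 0)))))
                (Pair (Call (ix Merge) (Pair (Left (Var 2)) (Pair (Left (Var 1)) (Left (Var 0)))))
                   (Right (Var 0)))))
          (Pair (Pair (Left (Right (Right arg))) Empty) (Right (Right (Right arg)))))
       truth"
| "body ix fa fc fe fo Loop =
     Cond (Left (Right arg))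
       (Bind (Left arg)
       (Bind (Pair Empty (Left (Right (Right (Var 1)))))
       (Bind (Call (ix Append)
          (Pair (Left (Right (Right (Var 1)))) (Left (Right (Right (Right (Var 2)))))))
       (Bind (Call (ix Candidates)
          (Pair (Pair (Var 2) (Call (ix Prefix) (Pair (Left (Right (Var 2))) (Var 1))))
             (Pair (Var 1) (Right (Right (Right (Right (Var 3))))))))
       (Call (ix Loop) (Pair (Var 3) (Pair (Right (Left (Right (Var 4)))) (Pair (Var 2)
          (Pair (Var 1) (Left (Call (ix Sort)
             (Pair (Left (Var 3)) (Pair (Var 1) (Var 0))))))))))))))
       (Right (Right (Right (Right arg))))"
| "body ix fa fc fe fo Full =
     Cond arg (Cond (Left arg) (Call (ix Full) (Right arg)) Empty) truth"
| "body ix fa fc fe fo Find =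
     Cond arg
       (Cond (Call (ix Full) (Right (Left arg)))
          (Pair Empty (Left arg))
          (Call (ix Find) (Right arg)))
       Empty"
| "body ix fa fc fe fo Main =
     Call (ix Find) (Call (ix Loop) (Pair arg (Pair (Left (Right arg)) (Pair Empty (Pair Empty
       (Call (ix Filter_Valid)
          (Pair (Pair arg (Call (ix Prefix) (Pair (Left (Right arg)) Empty)))
             (Pair (Pair (Left (Right (Right arg))) Empty) Empty))))))))"

section \<open>Tables of plans as trees, and list functions that specify the routines\<close>

lemma list_tree_eq_Leaf [simp]: "list_tree xs = Leaf \<longleftrightarrow> xs = []"
  by (cases xs) auto

definition entry :: "'u list \<Rightarrow> 'u option \<Rightarrow> tree" where
  "entry us z = (case z of None \<Rightarrow> Leaf | Some u \<Rightarrow> Node Leaf (user_tree us u))"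

lemma entry_eq_Leaf [simp]: "entry us z = Leaf \<longleftrightarrow> z = None"
  by (simp add: entry_def split: option.split)

lemma entry_None [simp]: "entry us None = Leaf"
  and right_entry_Some [simp]: "right (entry us (Some u)) = user_tree us u"
  by (simp_all add: entry_def)

definition row :: "'u list \<Rightarrow> 's list \<Rightarrow> ('s \<rightharpoonup> 'u) \<Rightarrow> tree" where
  "row us ss f = list_tree (map (\<lambda>s. entry us (f s)) ss)"

lemma row_Nil [simp]: "row us [] f = Leaf"
  and row_Cons [simp]: "row us (s # ss) f = Node (entry us (f s)) (row us ss f)"
  by (simp_all add: row_def)

lemma row_cong: "(\<And>s. s \<in> set ss \<Longrightarrow> f s = g s) \<Longrightarrow> row us ss f = row us ss g"
  by (simp add: row_def cong: map_cong)

fun extensions :: "'u \<Rightarrow> 's list \<Rightarrow> ('s \<rightharpoonup> 'u) \<Rightarrow> ('s \<rightharpoonup> 'u) list" where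
  "extensions u [] f = [f]"
| "extensions u (s # ss) f =
     (if f s = None then extensions u ss f @ map (\<lambda>g. g(s \<mapsto> u)) (extensions u ss f)
      else extensions u ss f)"

text \<open>On a tie, meaning \<open>le\<close> in both directions, the left head is dropped and the
  right one stays in play, where it can absorb or be absorbed by further elements.\<close>

fun merge :: "('a \<Rightarrow> 'a \<Rightarrow> bool) \<Rightarrow> 'a list \<Rightarrow> 'a list \<Rightarrow> 'a list" where
  "merge le [] ys = ys"
| "merge le xs [] = xs"
| "merge le (x # xs) (y # ys) =
     (if le x y then if le y x then merge le xs (y # ys) else x # merge le xs (y # ys)
      else y # merge le (x # xs) ys)"

text \<open>The depth \<open>d\<close> replaces the length: only the first \<open>2 ^ d\<close>
  elements are read. The routine obtains \<open>drop (2 ^ d) xs\<close> for free, as the rest that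
  its first recursive call leaves over.\<close>

fun msort :: "('a \<Rightarrow> 'a \<Rightarrow> bool) \<Rightarrow> nat \<Rightarrow> 'a list \<Rightarrow> 'a list" where
  "msort le 0 xs = take 1 xs"
| "msort le (Suc d) xs = merge le (msort le d xs) (msort le d (drop (2 ^ d) xs))"

lemma extensions_outside: "g \<in> set (extensions u ss f) \<Longrightarrow> s \<notin> set ss \<Longrightarrow> g s = f s"
  by (induction ss arbitrary: g) (auto split: if_splits)

lemma extensions_nonempty [simp]: "extensions u ss f \<noteq> []"
  by (induction ss) auto

lemma msort_Nil [simp]: "msort le d [] = []"
  by (induction d) auto

lemma length_merge: "length (merge le xs ys) \<le> length xs + length ys"
  by (induction le xs ys rule: merge.induct) auto

lemma length_msort: "length (msort le d xs) \<le> min (2 ^ d) (length xs)"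
proof (induction d arbitrary: xs)
  case (Suc d)
  show ?case
    using length_merge[of le "msort le d xs" "msort le d (drop (2 ^ d) xs)"]
      Suc.IH[of xs] Suc.IH[of "drop (2 ^ d) xs"]
    by (simp only: min.bounded_iff length_drop msort.simps power_Suc) linarith
qed simp

lemma set_merge: "set (merge le xs ys) \<subseteq> set xs \<union> set ys"
  by (induction le xs ys rule: merge.induct) auto

lemma set_msort: "set (msort le d xs) \<subseteq> set xs"
proof (induction d arbitrary: xs)
  case (Suc d)
  show ?case
    using set_merge[of le "msort le d xs" "msort le d (drop (2 ^ d) xs)"]
      set_drop_subset[of "2 ^ d" xs] Suc.IH[of xs] Suc.IH[of "drop (2 ^ d) xs"]
    unfolding msort.simps by blast
qed (auto dest: in_set_takeD)

section \<open>Correctness and running time of the single routines\<close>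

locale solver =
  fixes P :: program and ix :: "routine \<Rightarrow> nat" and fa fc fe fo :: nat
  assumes ix_less: "ix r < length P"
    and nth_ix: "P ! ix r = body ix fa fc fe fo r"
begin

lemma wp_call_ix: "wp_call P (ix r) x K \<longleftrightarrow> wp P [x] (body ix fa fc fe fo r) K"
  unfolding wp_call_def wp_def runs_def using ix_less nth_ix by auto

text \<open>Opens exactly one body: the calls inside it surface as \<open>wp_call\<close> only
  later, when \<open>wp_Call\<close> rewrites, and are then resolved by their own
  specifications.\<close>

lemmas unfold_call = computes_within_wp wp_call_ix body.simps

text \<open>The factor 20, like the other numerals in the bounds of this locale, is a rounded count
  of the steps of one pass through the body outside the calls it makes.\<close>

lemma computes_append:
  "computes_within P (ix Append) (Node (list_tree xs) (list_tree ys)) (list_tree (xs @ ys))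
     (20 * (length xs + 1))"
proof (induction xs)
  case Nil
  show ?case unfolding unfold_call by simp
next
  case (Cons x xs)
  show ?case unfolding unfold_call using computes_withinD[OF Cons.IH] by simp
qed

lemma computes_prefix:
  "computes_within P (ix Prefix) (Node (num_tree n) (num_tree i))
     (list_tree (map (\<lambda>j. bool_tree (j < i)) [0..<n])) (30 * (n + 1))"
proof (induction n arbitrary: i)
  case 0
  show ?case unfolding unfold_call by simp
next
  case (Suc n)
  have eq: "map (\<lambda>j. bool_tree (j < i)) [0..<Suc n] =
      bool_tree (0 < i) # map (\<lambda>j. bool_tree (j < i - 1)) [0..<n]"
    by (simp add: map_upt_Suc del: upt_Suc) (auto intro!: arg_cong[where f = bool_tree])
  \<comment> \<open>At \<open>i = 0\<close> the convention \<open>right Leaf = Leaf\<close> matches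
    truncated subtraction, so the counter may run out before the user list does.\<close>
  have r: "right (num_tree i) = num_tree (i - 1)"
    by (cases i) auto
  have z: "num_tree i = Leaf \<longleftrightarrow> i = 0"
    by (cases i) auto
  show ?case unfolding unfold_call eq using computes_withinD[OF Suc.IH[of "i - 1"]]
    by (cases i) (simp_all add: r z bool_tree_def)
qed

lemma computes_authorized:
  assumes "\<And>j u. j < length ss \<Longrightarrow> f (ss ! j) = Some u \<Longrightarrow>
      computes_within P fa (Node D (Node (num_tree (i + j)) (user_tree us u)))
        (bool_tree (u \<in> A (ss ! j))) B"
  shows "computes_within P (ix Authorized) (Node D (Node (num_tree i) (row us ss f)))
     (bool_tree (\<forall>s\<in>set ss. \<forall>u. f s = Some u \<longrightarrow> u \<in> A s)) ((B + 60) * (length ss + 1))"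
  using assms
proof (induction ss arbitrary: i)
  case Nil
  show ?case unfolding unfold_call by (simp add: bool_tree_def)
next
  case (Cons s ss)
  have IH: "computes_within P (ix Authorized) (Node D (Node (num_tree (Suc i)) (row us ss f)))
     (bool_tree (\<forall>s\<in>set ss. \<forall>u. f s = Some u \<longrightarrow> u \<in> A s)) ((B + 60) * (length ss + 1))"
  proof (rule Cons.IH)
    fix j u
    assume "j < length ss" "f (ss ! j) = Some u"
    then show "computes_within P fa (Node D (Node (num_tree (Suc i + j)) (user_tree us u)))
        (bool_tree (u \<in> A (ss ! j))) B"
      using Cons.prems[of "Suc j" u] by simp
  qed
  show ?case
  proof (cases "f s")
    case None
    show ?thesis unfolding unfold_call using computes_withinD[OF IH] None by simp
  next
    case (Some u)
    then have "computes_within P fa (Node D (Node (num_tree i) (user_tree us u)))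
        (bool_tree (u \<in> A s)) B"
      using Cons.prems[of 0 u] by simp
    from computes_withinD[OF this] show ?thesis
      unfolding unfold_call using computes_withinD[OF IH] Some
      by (cases "u \<in> A s") (simp_all add: bool_tree_def)
  qed
qed

lemma computes_constraints:
  assumes "\<And>i. i < j \<Longrightarrow> computes_within P fc (Node D (Node (num_tree i) x)) (bool_tree (Q i)) B"
  shows "computes_within P (ix Constraints) (Node D (Node (num_tree j) x))
     (bool_tree (\<forall>i<j. Q i)) ((B + 60) * (j + 1))"
  using assms
proof (induction j)
  case 0
  show ?case unfolding unfold_call by (simp add: bool_tree_def)
next
  case (Suc j)
  have IH: "computes_within P (ix Constraints) (Node D (Node (num_tree j) x))
     (bool_tree (\<forall>i<j. Q i)) ((B + 60) * (j + 1))"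
    using Suc by simp
  have all: "(\<forall>i<Suc j. Q i) \<longleftrightarrow> Q j \<and> (\<forall>i<j. Q i)"
    by (auto simp: less_Suc_eq)
  show ?case unfolding unfold_call all
    using computes_withinD[OF IH] computes_withinD[OF Suc.prems[of j]]
    by (cases "Q j") (simp_all add: bool_tree_def)
qed

lemma computes_conses:
  "computes_within P (ix Conses) (Node x (Node (list_tree ls) (list_tree out)))
     (list_tree (map (Node x) ls @ out)) (30 * (length ls + 1))"
proof (induction ls)
  case Nil
  show ?case unfolding unfold_call by simp
next
  case (Cons l ls)
  show ?case unfolding unfold_call using computes_withinD[OF Cons.IH] by simp
qed

text \<open>The partial lists never shrink as tasks are added, so each pass over them is bounded by
  the final number of extensions. A bound proportional to the output is what can later be summed
  over all plans of a level.\<close>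

lemma computes_extend:
  assumes "distinct ss"
  shows "computes_within P (ix Extend) (Node (entry us (Some u)) (row us ss f))
     (list_tree (map (row us ss) (extensions u ss f)))
     (200 * (length ss + 1) * length (extensions u ss f))"
  using assms
proof (induction ss)
  case Nil
  show ?case unfolding unfold_call by simp
next
  case (Cons s ss)
  define E where "E = extensions u ss f"
  define L where "L = map (row us ss) E"
  have IH: "computes_within P (ix Extend) (Node (entry us (Some u)) (row us ss f)) (list_tree L)
     (200 * (length ss + 1) * length E)"
    unfolding L_def E_def using Cons by simp
  \<comment> \<open>The list of extensions is never empty, so constant overheads fit into a bound
    proportional to its length.\<close>
  obtain z where E: "length E = Suc z" "length L = Suc z"
    by (cases E) (simp_all add: E_def L_def)
  \<comment> \<open>Distinctness of the tasks separates head and tail: an extension along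
    \<open>ss\<close> leaves \<open>f s\<close> alone, and an update at \<open>s\<close> leaves the
    row along \<open>ss\<close> alone.\<close>
  have old: "map (row us (s # ss)) E = map (Node (entry us (f s))) L"
    using Cons.prems extensions_outside[of _ u ss f s] by (auto simp: L_def E_def)
  have new: "map (row us (s # ss)) (map (\<lambda>g. g(s \<mapsto> u)) E) = map (Node (entry us (Some u))) L"
    using Cons.prems by (auto simp: L_def intro!: row_cong)
  have c: "computes_within P (ix Conses) (Node x (Node (list_tree L) Leaf))
     (list_tree (map (Node x) L)) (30 * (length E + 1))" for x
    using computes_conses[of x L "[]"] E by simp
  show ?case
  proof (cases "f s")
    case None
    note c' = computes_conses[of Leaf L "map (Node (entry us (Some u))) L"]
    have "map (row us (s # ss)) (extensions u (s # ss) f) =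
        map (Node Leaf) L @ map (Node (entry us (Some u))) L"
      using old new None unfolding E_def[symmetric] by (simp add: E_def)
    then show ?thesis
      unfolding unfold_call
      using computes_withinD[OF IH] computes_withinD[OF c, of "entry us (Some u)"]
        computes_withinD[OF c'] None E
      by (simp add: E_def[symmetric] algebra_simps)
  next
    case (Some v)
    have "map (row us (s # ss)) (extensions u (s # ss) f) = map (Node (entry us (Some v))) L"
      using old Some by (simp add: E_def)
    then show ?thesis
      unfolding unfold_call
      using computes_withinD[OF IH] computes_withinD[OF c, of "entry us (Some v)"] Some E
      by (simp add: E_def[symmetric] algebra_simps)
  qed
qed

lemma computes_filter_valid:
  assumes "\<And>x. x \<in> set xs \<Longrightarrow>
      computes_within P (ix Check) (Node I (Node X (c x))) (bool_tree (Q x)) B"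
  shows "computes_within P (ix Filter_Valid)
     (Node (Node I X) (Node (list_tree (map c xs)) (list_tree out)))
     (list_tree (map (\<lambda>x. Node X (c x)) (filter Q xs) @ out)) ((B + 60) * (length xs + 1))"
  using assms
proof (induction xs)
  case Nil
  show ?case unfolding unfold_call by simp
next
  case (Cons x xs)
  have IH: "computes_within P (ix Filter_Valid)
     (Node (Node I X) (Node (list_tree (map c xs)) (list_tree out)))
     (list_tree (map (\<lambda>x. Node X (c x)) (filter Q xs) @ out)) ((B + 60) * (length xs + 1))"
    using Cons by simp
  show ?case unfolding unfold_call
    using computes_withinD[OF IH] computes_withinD[OF Cons.prems[of x]] by (cases "Q x") simp_all
qed

lemma computes_candidates:
  assumes "\<And>x. x \<in> set xs \<Longrightarrow>
      computes_within P (ix Extend) (Node e (c x)) (list_tree (map d (E x))) (BE * length (E x))"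
    and "\<And>x y. x \<in> set xs \<Longrightarrow> y \<in> set (E x) \<Longrightarrow>
      computes_within P (ix Check) (Node I (Node X (d y))) (bool_tree (Q y)) BC"
    and "\<And>x. x \<in> set xs \<Longrightarrow> 0 < length (E x)"
  shows "computes_within P (ix Candidates)
     (Node (Node I X) (Node e (list_tree (map (\<lambda>x. Node (b x) (c x)) xs))))
     (list_tree (map (\<lambda>y. Node X (d y)) (filter Q (concat (map E xs)))))
     ((BE + 2 * BC + 200) * (length (concat (map E xs)) + 1))"
  using assms
proof (induction xs)
  case Nil
  show ?case unfolding unfold_call by simp
next
  case (Cons x xs)
  define out where "out = map (\<lambda>y. Node X (d y)) (filter Q (concat (map E xs)))"
  have IH: "computes_within P (ix Candidates)
     (Node (Node I X) (Node e (list_tree (map (\<lambda>x. Node (b x) (c x)) xs)))) (list_tree out)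
     ((BE + 2 * BC + 200) * (length (concat (map E xs)) + 1))"
    unfolding out_def by (rule Cons.IH) (use Cons.prems in auto)
  have ext: "computes_within P (ix Extend) (Node e (c x)) (list_tree (map d (E x)))
      (BE * length (E x))"
    using Cons.prems(1) by simp
  have filt: "computes_within P (ix Filter_Valid)
     (Node (Node I X) (Node (list_tree (map d (E x))) (list_tree out)))
     (list_tree (map (\<lambda>y. Node X (d y)) (filter Q (E x)) @ out)) ((BC + 60) * (length (E x) + 1))"
    by (rule computes_filter_valid) (use Cons.prems(2) in auto)
  have "0 < length (E x)"
    by (rule Cons.prems(3)) simp
  then obtain z where z: "length (E x) = Suc z"
    using gr0_implies_Suc by blast
  \<comment> \<open>Every plan has an extension, so the \<open>+ 1\<close> costs at most a factor 2;
    hence \<open>2 * BC\<close> in the bound.\<close>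
  have "(BC + 60) * (length (E x) + 1) \<le> (BC + 60) * (2 * length (E x))"
    unfolding z by (intro mult_le_mono2) simp
  then show ?case unfolding unfold_call
    using computes_withinD[OF IH] computes_withinD[OF ext] computes_withinD[OF filt] z
    by (simp add: algebra_simps flip: out_def)
qed

lemma computes_support:
  "computes_within P (ix Support) (row us ss f) (set_tree ss (dom f)) (30 * (length ss + 1))"
proof (induction ss)
  case Nil
  show ?case unfolding unfold_call by (simp add: set_tree_def)
next
  case (Cons s ss)
  show ?case unfolding unfold_call using computes_withinD[OF Cons.IH]
    by (cases "f s") (simp_all add: set_tree_def bool_tree_def domIff)
qed

text \<open>The Boolean lists are never built: emptiness of an entry stands for
  \<open>False\<close>, which is below \<open>True\<close>, and the lexicographic order is decided
  at the first difference.\<close>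

lemma computes_less:
  "computes_within P (ix Less) (Node (row us ss f) (row us ss g))
     (bool_tree (map (\<lambda>s. f s \<noteq> None) ss < map (\<lambda>s. g s \<noteq> None) ss)) (60 * (length ss + 1))"
proof (induction ss)
  case Nil
  show ?case unfolding unfold_call by (simp add: bool_tree_def)
next
  case (Cons s ss)
  show ?case unfolding unfold_call using computes_withinD[OF Cons.IH]
    by (cases "f s"; cases "g s") (simp_all add: bool_tree_def)
qed

text \<open>Each recursive step consumes one element and makes at most two comparisons, one in each
  direction; hence \<open>2 * B\<close>.\<close>

lemma computes_merge:
  assumes "\<And>x y. x \<in> A \<Longrightarrow> y \<in> A \<Longrightarrow>
      computes_within P (ix Le) (Node D (Node (c x) (c y))) (bool_tree (le x y)) B"
    and "set xs \<subseteq> A" "set ys \<subseteq> A"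
  shows "computes_within P (ix Merge) (Node D (Node (list_tree (map c xs)) (list_tree (map c ys))))
     (list_tree (map c (merge le xs ys))) ((2 * B + 120) * (length xs + length ys + 1))"
  using assms
proof (induction le xs ys rule: merge.induct)
  case (1 le ys)
  show ?case unfolding unfold_call by simp
next
  case (2 le x xs)
  show ?case unfolding unfold_call by simp
next
  case (3 le x xs y ys)
  note le = "3.prems"(1)
  have xy: "x \<in> A" "y \<in> A" "set xs \<subseteq> A" "set ys \<subseteq> A"
    using "3.prems" by auto
  note cmp = computes_withinD[OF le[OF xy(1,2)]] computes_withinD[OF le[OF xy(2,1)]]
  show ?case
  proof (cases "le x y")
    case True
    \<comment> \<open>The induction rule treats the two outcomes of the tie test separately, but
      both recurse on the same pair, so the routine may recurse before testing for a tie.\<close>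
    have IH: "computes_within P (ix Merge)
        (Node D (Node (list_tree (map c xs)) (list_tree (map c (y # ys)))))
        (list_tree (map c (merge le xs (y # ys)))) ((2 * B + 120) * (length xs + length (y # ys) + 1))"
    proof (cases "le y x")
      case yx: True
      show ?thesis by (rule "3.IH"(1)[OF True yx le]) (use xy in auto)
    next
      case yx: False
      show ?thesis by (rule "3.IH"(2)[OF True yx le]) (use xy in auto)
    qed
    show ?thesis
      unfolding unfold_call using True cmp computes_withinD[OF IH]
      by (cases "le y x") (simp_all add: algebra_simps)
  next
    case False
    have IH: "computes_within P (ix Merge)
        (Node D (Node (list_tree (map c (x # xs))) (list_tree (map c ys))))
        (list_tree (map c (merge le (x # xs) ys))) ((2 * B + 120) * (length (x # xs) + length ys + 1))"
      by (rule "3.IH"(3)[OF False le]) (use xy in auto)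
    show ?thesis
      unfolding unfold_call using False cmp computes_withinD[OF IH] by (simp add: algebra_simps)
  qed
qed

text \<open>The recursion tree of depth \<open>d\<close> is not explored in full: a call on an empty
  rest returns at once, which the additive 10 pays for. Hence the minimum with
  \<open>length xs\<close>, without which the cost would be exponential in the depth.\<close>

lemma computes_sort:
  assumes le: "\<And>x y. x \<in> A \<Longrightarrow> y \<in> A \<Longrightarrow>
      computes_within P (ix Le) (Node D (Node (c x) (c y))) (bool_tree (le x y)) B"
    and "set xs \<subseteq> A"
  shows "computes_within P (ix Sort) (Node D (Node (num_tree d) (list_tree (map c xs))))
     (Node (list_tree (map c (msort le d xs))) (list_tree (map c (drop (2 ^ d) xs))))
     ((4 * B + 500) * (d + 1) * min (2 ^ d) (length xs) + 10)"
  using assms(2)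
proof (induction d arbitrary: xs)
  case 0
  show ?case
    unfolding unfold_call by (cases xs) simp_all
next
  case (Suc d)
  define ys where "ys = drop (2 ^ d) xs"
  define N1 where "N1 = min (2 ^ d) (length xs)"
  define N2 where "N2 = min (2 ^ d) (length ys)"
  have ys: "set ys \<subseteq> A"
    using Suc.prems set_drop_subset[of "2 ^ d" xs] by (auto simp: ys_def)
  note IH1 = Suc.IH[OF Suc.prems, folded ys_def N1_def]
  note IH2 = Suc.IH[OF ys, folded N2_def]
  have sets: "set (msort le d xs) \<subseteq> A" "set (msort le d ys) \<subseteq> A"
    by (rule order_trans[OF set_msort Suc.prems], rule order_trans[OF set_msort ys])
  have "length (msort le d xs) + length (msort le d ys) + 1 \<le> N1 + N2 + 1"
    using length_msort[of le d xs] length_msort[of le d ys] unfolding N1_def N2_def by linarith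
  then have "(2 * B + 120) * (length (msort le d xs) + length (msort le d ys) + 1)
      \<le> (2 * B + 120) * (N1 + N2 + 1)"
    by (rule mult_le_mono2)
  note merge = computes_within_mono[OF computes_merge[where c = c and le = le, OF le sets] this]
  have rest: "drop (2 ^ d) ys = drop (2 ^ Suc d) xs"
    by (simp add: ys_def mult_2)
  show ?case
  proof (cases "xs = []")
    case True
    then show ?thesis unfolding unfold_call by simp
  next
    case False
    then have N: "0 < N1" "min (2 ^ Suc d) (length xs) = N1 + N2"
      by (auto simp: N1_def N2_def ys_def)
    \<comment> \<open>As \<open>N1 > 0\<close>, the merge bound for \<open>N1 + N2 + 1\<close> is at
      most that for \<open>2 * (N1 + N2)\<close>, which turns \<open>2 * B\<close> into
      \<open>4 * B\<close>. Together with the constants it fits into the increase of the depth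
      factor by one.\<close>
    have bound: "(4 * B + 500) * (d + 1) * N1 + 10 + ((4 * B + 500) * (d + 1) * N2 + 10) +
        (2 * B + 120) * (N1 + N2 + 1) + 200 \<le> (4 * B + 500) * (Suc d + 1) * (N1 + N2)"
    proof -
      have "(2 * B + 120) * (N1 + N2 + 1) + 220 \<le> (2 * B + 120) * (2 * (N1 + N2)) + 220 * (N1 + N2)"
        using N(1) by (intro add_mono mult_le_mono2) auto
      then show ?thesis by (simp add: algebra_simps)
    qed
    show ?thesis
      unfolding unfold_call N rest[symmetric]
      using computes_withinD[OF IH1] computes_withinD[OF IH2] computes_withinD[OF merge] False bound
      by (simp add: ys_def[symmetric])
  qed
qed

lemma computes_full:
  "computes_within P (ix Full) (row us ss f) (bool_tree (set ss \<subseteq> dom f)) (30 * (length ss + 1))"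
proof (induction ss)
  case Nil
  show ?case unfolding unfold_call by (simp add: bool_tree_def)
next
  case (Cons s ss)
  show ?case unfolding unfold_call using computes_withinD[OF Cons.IH]
    by (cases "f s") (auto simp add: bool_tree_def domIff)
qed

lemma computes_find:
  "computes_within P (ix Find) (list_tree (map (\<lambda>\<pi>. Node (X \<pi>) (row us ss (snd \<pi>))) \<pi>s))
     (case find (\<lambda>\<pi>. set ss \<subseteq> dom (snd \<pi>)) \<pi>s of None \<Rightarrow> Leaf
      | Some \<pi> \<Rightarrow> Node Leaf (Node (X \<pi>) (row us ss (snd \<pi>)))) (60 * (length ss + 1) * (length \<pi>s + 1))"
proof (induction \<pi>s)
  case Nil
  show ?case unfolding unfold_call by simp
next
  case (Cons \<pi> \<pi>s)
  show ?case unfolding unfold_call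
    using computes_withinD[OF Cons.IH] computes_withinD[OF computes_full[of us ss "snd \<pi>"]]
    by (cases "set ss \<subseteq> dom (snd \<pi>)") (simp_all add: algebra_simps)
qed

end


section \<open>Sorting modulo equivalence\<close>

text \<open>Sortedness for the strict part of \<open>le\<close> also excludes ties within a list, so
  it yields order and inequivalence together. The assumptions are relative to \<open>A\<close>
  because the order on plans is total only for a fixed user set.\<close>

lemma merge_sorted:
  assumes "\<And>x y. x \<in> A \<Longrightarrow> y \<in> A \<Longrightarrow> le x y \<or> le y x"
    and "\<And>x y z. x \<in> A \<Longrightarrow> y \<in> A \<Longrightarrow> z \<in> A \<Longrightarrow> le x y \<Longrightarrow> le y z \<Longrightarrow> le x z"
    and "set xs \<subseteq> A" "set ys \<subseteq> A"
    and "sorted_wrt (\<lambda>x y. le x y \<and> \<not> le y x) xs" "sorted_wrt (\<lambda>x y. le x y \<and> \<not> le y x) ys"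
  shows "sorted_wrt (\<lambda>x y. le x y \<and> \<not> le y x) (merge le xs ys)"
  using assms
proof (induction le xs ys rule: merge.induct)
  case (3 le x xs y ys)
  note total = "3.prems"(1) and trans = "3.prems"(2)
  have A: "x \<in> A" "y \<in> A" "set xs \<subseteq> A" "set ys \<subseteq> A"
    using "3.prems"(3-) by auto
  have x: "\<forall>z\<in>set xs. le x z \<and> \<not> le z x" and y: "\<forall>z\<in>set ys. le y z \<and> \<not> le z y"
    using "3.prems"(3-) by auto
  consider "le x y" "le y x" | "le x y" "\<not> le y x" | "\<not> le x y"
    by blast
  then show ?case
  proof cases
    case 1
    have "sorted_wrt (\<lambda>x y. le x y \<and> \<not> le y x) (merge le xs (y # ys))"
      by (rule "3.IH"(1)[OF 1 total trans]) (use "3.prems"(3-) in auto)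
    with 1 show ?thesis by simp
  next
    case 2
    have IH: "sorted_wrt (\<lambda>x y. le x y \<and> \<not> le y x) (merge le xs (y # ys))"
      by (rule "3.IH"(2)[OF 2 total trans]) (use "3.prems"(3-) in auto)
    have "le x z \<and> \<not> le z x" if "z \<in> set ys" for z
    proof -
      have "z \<in> A" "le y z" "\<not> le z y"
        using that A y by auto
      then show ?thesis
        using trans[of x y z] trans[of z x y] A 2 by blast
    qed
    with x 2 have "\<forall>z\<in>set (merge le xs (y # ys)). le x z \<and> \<not> le z x"
      using set_merge[of le xs "y # ys"] by auto
    with 2 IH show ?thesis by simp
  next
    case 3
    have IH: "sorted_wrt (\<lambda>x y. le x y \<and> \<not> le y x) (merge le (x # xs) ys)"
      by (rule "3.IH"(3)[OF 3 total trans]) (use "3.prems"(3-) in auto)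
    have yx: "le y x"
      using total A 3 by blast
    have "le y z \<and> \<not> le z y" if "z \<in> set xs" for z
    proof -
      have "z \<in> A" "le x z" "\<not> le z x"
        using that A x by auto
      then show ?thesis
        using trans[of y x z] trans[of x z y] A 3 yx by blast
    qed
    with y 3 yx have "\<forall>z\<in>set (merge le (x # xs) ys). le y z \<and> \<not> le z y"
      using set_merge[of le "x # xs" ys] by auto
    with 3 IH show ?thesis by simp
  qed
next
  case (1 le ys)
  show ?case using "1.prems"(6) by simp
next
  case (2 le x xs)
  show ?case using "2.prems"(5) by simp
qed

text \<open>A dropped head is tied with an element that may itself be dropped later. The induction
  hypothesis supplies a survivor tied with that element, and ties compose by transitivity.\<close>

lemma merge_covers:
  assumes "\<And>x y. x \<in> A \<Longrightarrow> y \<in> A \<Longrightarrow> le x y \<or> le y x"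
    and "\<And>x y z. x \<in> A \<Longrightarrow> y \<in> A \<Longrightarrow> z \<in> A \<Longrightarrow> le x y \<Longrightarrow> le y z \<Longrightarrow> le x z"
    and "set xs \<subseteq> A" "set ys \<subseteq> A"
  shows "\<forall>z\<in>set xs \<union> set ys. \<exists>z'\<in>set (merge le xs ys). le z z' \<and> le z' z"
  using assms
proof (induction le xs ys rule: merge.induct)
  case (3 le x xs y ys)
  note total = "3.prems"(1) and trans = "3.prems"(2)
  have A: "x \<in> A" "y \<in> A" "set xs \<subseteq> A" "set ys \<subseteq> A"
    using "3.prems"(3-) by auto
  have refl: "le z z" if "z \<in> A" for z
    using total that by blast
  consider "le x y" "le y x" | "le x y" "\<not> le y x" | "\<not> le x y"
    by blast
  then show ?case
  proof cases
    case 1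
    have IH: "\<forall>z\<in>set xs \<union> set (y # ys). \<exists>z'\<in>set (merge le xs (y # ys)). le z z' \<and> le z' z"
      by (rule "3.IH"(1)[OF 1 total trans]) (use "3.prems"(3-) in auto)
    then obtain z where z: "z \<in> set (merge le xs (y # ys))" "le y z" "le z y"
      by auto
    then have "z \<in> A"
      using set_merge[of le xs "y # ys"] A by auto
    then have "le x z \<and> le z x"
      using trans[of x y z] trans[of z y x] A z 1 by blast
    with 1 IH z(1) show ?thesis by auto
  next
    case 2
    have "\<forall>z\<in>set xs \<union> set (y # ys). \<exists>z'\<in>set (merge le xs (y # ys)). le z z' \<and> le z' z"
      by (rule "3.IH"(2)[OF 2 total trans]) (use "3.prems"(3-) in auto)
    with 2 refl[OF A(1)] show ?thesis by auto
  next
    case 3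
    have "\<forall>z\<in>set (x # xs) \<union> set ys. \<exists>z'\<in>set (merge le (x # xs) ys). le z z' \<and> le z' z"
      by (rule "3.IH"(3)[OF 3 total trans]) (use "3.prems"(3-) in auto)
    with 3 refl[OF A(2)] show ?thesis by auto
  qed
next
  case (1 le ys)
  have "le z z" if "z \<in> set ys" for z
    using "1.prems"(1)[of z z] "1.prems"(4) that by blast
  then show ?case by auto
next
  case (2 le x xs)
  have "le z z" if "z \<in> set (x # xs)" for z
    using "2.prems"(1)[of z z] "2.prems"(3) that by blast
  then show ?case by auto
qed

lemma msort_sorted:
  assumes total: "\<And>x y. x \<in> A \<Longrightarrow> y \<in> A \<Longrightarrow> le x y \<or> le y x"
    and trans: "\<And>x y z. x \<in> A \<Longrightarrow> y \<in> A \<Longrightarrow> z \<in> A \<Longrightarrow> le x y \<Longrightarrow> le y z \<Longrightarrow> le x z"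
    and "set xs \<subseteq> A"
  shows "sorted_wrt (\<lambda>x y. le x y \<and> \<not> le y x) (msort le d xs)"
  using assms(3)
proof (induction d arbitrary: xs)
  case 0
  show ?case by (cases xs) auto
next
  case (Suc d)
  have ys: "set (drop (2 ^ d) xs) \<subseteq> A"
    using Suc.prems set_drop_subset[of "2 ^ d" xs] by blast
  show ?case
    unfolding msort.simps
    by (rule merge_sorted[where le = le, OF total trans order_trans[OF set_msort Suc.prems]
          order_trans[OF set_msort ys] Suc.IH[OF Suc.prems] Suc.IH[OF ys]])
qed

lemma msort_covers:
  assumes total: "\<And>x y. x \<in> A \<Longrightarrow> y \<in> A \<Longrightarrow> le x y \<or> le y x"
    and trans: "\<And>x y z. x \<in> A \<Longrightarrow> y \<in> A \<Longrightarrow> z \<in> A \<Longrightarrow> le x y \<Longrightarrow> le y z \<Longrightarrow> le x z"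
    and "set xs \<subseteq> A" "z \<in> set (take (2 ^ d) xs)"
  shows "\<exists>z'\<in>set (msort le d xs). le z z' \<and> le z' z"
  using assms(3,4)
proof (induction d arbitrary: xs)
  case 0
  then show ?case using total by (cases xs) auto
next
  case (Suc d)
  define ys where "ys = drop (2 ^ d) xs"
  have ys: "set ys \<subseteq> A"
    using Suc.prems set_drop_subset[of "2 ^ d" xs] by (auto simp: ys_def)
  have "take (2 ^ Suc d) xs = take (2 ^ d) xs @ take (2 ^ d) ys"
    by (simp add: ys_def mult_2 take_add)
  then have "z \<in> set (take (2 ^ d) xs) \<or> z \<in> set (take (2 ^ d) ys)"
    using Suc.prems(2) by auto
  then obtain y where y: "y \<in> set (msort le d xs) \<union> set (msort le d ys)" "le z y" "le y z"
    using Suc.IH[OF Suc.prems(1)] Suc.IH[OF ys] by blast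
  have sets: "set (msort le d xs) \<subseteq> A" "set (msort le d ys) \<subseteq> A"
    by (rule order_trans[OF set_msort Suc.prems(1)], rule order_trans[OF set_msort ys])
  have "\<forall>z\<in>set (msort le d xs) \<union> set (msort le d ys).
      \<exists>z'\<in>set (merge le (msort le d xs) (msort le d ys)). le z z' \<and> le z' z"
    by (rule merge_covers[where le = le and A = A]) (fact total trans sets)+
  with y(1) obtain z' where z': "z' \<in> set (msort le (Suc d) xs)" "le y z'" "le z' y"
    by (auto simp: ys_def)
  have A: "z \<in> A" "y \<in> A" "z' \<in> A"
    using subsetD[OF Suc.prems(1) in_set_takeD[OF Suc.prems(2)]] y(1) sets
      subsetD[OF order_trans[OF set_msort Suc.prems(1)] z'(1)] by auto
  have "le z z'" "le z' z"
    using trans[OF A y(2) z'(2)] trans[OF A(3,2,1) z'(3) y(3)] by auto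
  with z'(1) show ?case by blast
qed


section \<open>Counting extensions\<close>

lemma set_extensions:
  "g \<in> set (extensions u ss f) \<longleftrightarrow>
     (\<forall>s. g s = f s \<or> f s = None \<and> s \<in> set ss \<and> g s = Some u)"
proof (induction ss arbitrary: g)
  case Nil
  show ?case by auto
next
  case (Cons s ss)
  show ?case
  proof (cases "f s")
    case None
    show ?thesis
    proof
      assume "g \<in> set (extensions u (s # ss) f)"
      then consider "g \<in> set (extensions u ss f)"
        | h where "h \<in> set (extensions u ss f)" "g = h(s \<mapsto> u)"
        using None by auto
      then show "\<forall>s'. g s' = f s' \<or> f s' = None \<and> s' \<in> set (s # ss) \<and> g s' = Some u"
      proof cases
        case 1
        then show ?thesis unfolding Cons.IH by auto
      next
        case 2
        then show ?thesis unfolding Cons.IH using None by auto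
      qed
    next
      assume g: "\<forall>s'. g s' = f s' \<or> f s' = None \<and> s' \<in> set (s # ss) \<and> g s' = Some u"
      show "g \<in> set (extensions u (s # ss) f)"
      proof (cases "g s")
        case None
        then have "g \<in> set (extensions u ss f)"
          unfolding Cons.IH using g by (metis option.distinct(1) set_ConsD)
        then show ?thesis by simp
      next
        case (Some v)
        then have "v = u"
          using g \<open>f s = None\<close> by (metis option.distinct(1) option.inject)
        \<comment> \<open>Erasing the assignment at \<open>s\<close> gives the preimage under the
          update; it is an extension along \<open>ss\<close> because
          \<open>f s = None\<close>.\<close>
        then have "g = (g(s := None))(s \<mapsto> u)"
          using Some by auto
        moreover have "g(s := None) \<in> set (extensions u ss f)"
          unfolding Cons.IH using g \<open>f s = None\<close> by auto
        ultimately have "g \<in> (\<lambda>h. h(s \<mapsto> u)) ` set (extensions u ss f)"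
          by (rule image_eqI)
        then show ?thesis using \<open>f s = None\<close> by simp
      qed
    qed
  next
    case (Some v)
    then have "g \<in> set (extensions u (s # ss) f) \<longleftrightarrow> g \<in> set (extensions u ss f)"
      by simp
    also have "\<dots> \<longleftrightarrow> (\<forall>s'. g s' = f s' \<or> f s' = None \<and> s' \<in> set (s # ss) \<and> g s' = Some u)"
      unfolding Cons.IH using Some by (metis list.set_intros(2) option.distinct(1) set_ConsD)
    finally show ?thesis .
  qed
qed

lemma length_extensions:
  "distinct ss \<Longrightarrow> length (extensions u ss f) = 2 ^ card (set ss - dom f)"
  by (induction ss) (auto simp: insert_Diff_if domIff)

text \<open>Each element of \<open>S\<close> is in \<open>T\<close>, or outside with weight 2: three
  options per element, the binomial expansion of (1 + 2)^|S|.\<close>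

lemma sum_Pow_complement:
  assumes "finite S"
  shows "(\<Sum>T\<in>Pow S. 2 ^ card (S - T)) = (3 ^ card S :: nat)"
  using assms
proof (induction S)
  case empty
  show ?case by simp
next
  case (insert x S)
  have disj: "Pow S \<inter> insert x ` Pow S = {}"
    using insert.hyps by auto
  have inj: "inj_on (insert x) (Pow S)"
    using insert.hyps by (auto simp: inj_on_def)
  have 1: "card (insert x S - T) = Suc (card (S - T))" if "T \<in> Pow S" for T
  proof -
    have "insert x S - T = insert x (S - T)"
      using that insert.hyps by auto
    then show ?thesis using insert.hyps by simp
  qed
  have 2: "insert x S - insert x T = S - T" for T
    using insert.hyps by auto
  have "(\<Sum>T\<in>Pow (insert x S). 2 ^ card (insert x S - T)) =
      (\<Sum>T\<in>Pow S. 2 ^ card (insert x S - T)) +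
      (\<Sum>T\<in>insert x ` Pow S. 2 ^ card (insert x S - T) :: nat)"
    unfolding Pow_insert using insert.hyps disj by (intro sum.union_disjoint) auto
  also have "\<dots> = (\<Sum>T\<in>Pow S. 2 * 2 ^ card (S - T)) + (\<Sum>T\<in>Pow S. 2 ^ card (S - T))"
    using 1 2 by (simp add: sum.reindex[OF inj])
  also have "\<dots> = 3 ^ card (insert x S)"
    using insert by (simp add: sum_distrib_left[symmetric])
  finally show ?case .
qed

text \<open>Grouping by task set turns a bound for each single task set into a bound for all
  extensions of a level.\<close>

lemma sum_free_tasks_le:
  fixes \<pi>s :: "('s, 'u) plan list"
  assumes "finite S" "distinct \<pi>s" "\<And>\<pi>. \<pi> \<in> set \<pi>s \<Longrightarrow> tasks \<pi> \<subseteq> S"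
    and "\<And>T. T \<subseteq> S \<Longrightarrow> card {\<pi> \<in> set \<pi>s. tasks \<pi> = T} \<le> W"
  shows "(\<Sum>\<pi>\<leftarrow>\<pi>s. 2 ^ card (S - tasks \<pi>)) \<le> (W * 3 ^ card S :: nat)"
proof -
  have "(\<Sum>\<pi>\<leftarrow>\<pi>s. 2 ^ card (S - tasks \<pi>)) = (\<Sum>\<pi>\<in>set \<pi>s. 2 ^ card (S - tasks \<pi>) :: nat)"
    using assms(2) by (rule sum_list_distinct_conv_sum_set)
  also have "\<dots> = (\<Sum>T\<in>Pow S. \<Sum>\<pi>\<in>{\<pi> \<in> set \<pi>s. tasks \<pi> = T}. 2 ^ card (S - tasks \<pi>))"
    by (rule sum.group[symmetric]) (use assms in auto)
  also have "\<dots> = (\<Sum>T\<in>Pow S. card {\<pi> \<in> set \<pi>s. tasks \<pi> = T} * 2 ^ card (S - T))"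
    by simp
  also have "\<dots> \<le> (\<Sum>T\<in>Pow S. W * 2 ^ card (S - T))"
    using assms(4) by (intro sum_mono mult_le_mono1) auto
  also have "\<dots> = W * 3 ^ card S"
    using sum_Pow_complement[OF assms(1)] by (simp add: sum_distrib_left[symmetric])
  finally show ?thesis .
qed


section \<open>Width\<close>

lemma finite_eligible:
  assumes "finite S" "finite U"
  shows "finite {\<pi> :: ('s, 'u) plan. eligible S U C \<pi>}"
proof -
  have "finite (\<Union>T\<in>Pow S. {f :: 's \<rightharpoonup> 'u. dom f = T \<and> ran f \<subseteq> U})"
    using assms by (intro finite_UN_I finite_set_of_finite_maps) (auto intro: finite_subset)
  moreover have "{\<pi> :: ('s, 'u) plan. eligible S U C \<pi>} \<subseteq>
      Pow U \<times> (\<Union>T\<in>Pow S. {f. dom f = T \<and> ran f \<subseteq> U})"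
    by (auto simp: eligible_def is_plan_def)
  ultimately show ?thesis
    using assms(2) by (meson finite_Pow_iff finite_SigmaI finite_subset)
qed

text \<open>Sending a plan to its class is injective on \<open>Z\<close> and lands among the classes
  that the width counts for \<open>i\<close> and \<open>T\<close>. Finiteness of the set of eligible
  plans makes these cardinalities meaningful.\<close>

lemma card_inequivalent_le_width:
  assumes "finite S" "equiv {\<pi>. eligible S (set us) C \<pi>} R" "i \<in> {1..length us}" "T \<subseteq> S"
    and Z: "Z \<subseteq> eligible_plans S (set us) C (set (take i us)) T"
    and inj: "\<And>\<pi> \<pi>'. \<pi> \<in> Z \<Longrightarrow> \<pi>' \<in> Z \<Longrightarrow> (\<pi>, \<pi>') \<in> R \<Longrightarrow> \<pi> = \<pi>'"
  shows "card Z \<le> width S us C R"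
proof -
  let ?E = "{\<pi>. eligible S (set us) C \<pi>}"
  let ?cl = "\<lambda>i T. {c \<in> ?E // R. c \<inter> eligible_plans S (set us) C (set (take i us)) T \<noteq> {}}"
  have ZE: "Z \<subseteq> ?E"
    using Z by (auto simp: eligible_plans_def)
  have "inj_on (\<lambda>\<pi>. R `` {\<pi>}) Z"
  proof (rule inj_onI)
    fix \<pi> \<pi>'
    assume *: "\<pi> \<in> Z" "\<pi>' \<in> Z" "R `` {\<pi>} = R `` {\<pi>'}"
    then have "(\<pi>, \<pi>') \<in> R"
      using eq_equiv_class_iff[OF assms(2) subsetD[OF ZE] subsetD[OF ZE]] by blast
    with * show "\<pi> = \<pi>'" by (intro inj)
  qed
  moreover have "(\<lambda>\<pi>. R `` {\<pi>}) ` Z \<subseteq> ?cl i T"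
  proof
    fix c
    assume "c \<in> (\<lambda>\<pi>. R `` {\<pi>}) ` Z"
    then obtain \<pi> where \<pi>: "\<pi> \<in> Z" "c = R `` {\<pi>}"
      by blast
    then have "\<pi> \<in> c"
      using equiv_class_self[OF assms(2) subsetD[OF ZE]] by blast
    with \<pi> Z ZE show "c \<in> ?cl i T"
      by (auto intro: quotientI)
  qed
  moreover have "finite (?cl i T)"
    using finite_quotient[OF finite_eligible[OF assms(1)] equiv_type[OF assms(2)]] by simp
  ultimately have "card Z \<le> card (?cl i T)"
    by (meson card_inj_on_le)
  also have "\<dots> \<le> width S us C R"
    unfolding width_def
  proof (rule Max_ge)
    have "{card (?cl i T) |i T. i \<in> {1..length us} \<and> T \<subseteq> S} \<subseteq>
        (\<lambda>(i, T). card (?cl i T)) ` ({1..length us} \<times> Pow S)"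
      by auto
    then show "finite (insert 0 {card (?cl i T) |i T. i \<in> {1..length us} \<and> T \<subseteq> S})"
      using assms(1) by (simp add: finite_subset)
  qed (use assms(3,4) in auto)
  finally show ?thesis .
qed


section \<open>The dynamic program\<close>

lemma sorted_wrt_trichotomy:
  "sorted_wrt Q xs \<Longrightarrow> x \<in> set xs \<Longrightarrow> y \<in> set xs \<Longrightarrow> x = y \<or> Q x y \<or> Q y x"
  by (induction xs) auto

lemma sorted_wrt_distinct: "sorted_wrt Q xs \<Longrightarrow> (\<And>x. \<not> Q x x) \<Longrightarrow> distinct xs"
  by (induction xs) auto

lemma plan_tree_row: "plan_tree ss us \<pi> = Node (set_tree us (users \<pi>)) (row us ss (snd \<pi>))"
  by (simp add: plan_tree_def row_def entry_def)

lemma plan_tree_fun: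
  "plan_tree ss us = (\<lambda>\<pi>. Node (set_tree us (users \<pi>)) (row us ss (snd \<pi>)))"
  by (rule ext) (rule plan_tree_row)

lemma user_tree_num: "u \<in> set us \<Longrightarrow> \<exists>j<length us. us ! j = u \<and> user_tree us u = num_tree j"
  unfolding user_tree_def in_set_conv_nth by (metis (mono_tags, lifting) LeastI_ex)

lemma user_tree_nth: "distinct us \<Longrightarrow> j < length us \<Longrightarrow> user_tree us (us ! j) = num_tree j"
  using user_tree_num[of "us ! j" us] by (auto simp: nth_eq_iff_index_eq)

lemma set_tree_take:
  assumes "distinct us"
  shows "set_tree us (set (take i us)) = list_tree (map (\<lambda>j. bool_tree (j < i)) [0..<length us])"
proof -
  have "us ! j \<in> set (take i us) \<longleftrightarrow> j < i" if "j < length us" for j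
    using assms that by (auto simp: in_set_conv_nth nth_eq_iff_index_eq)
  then have "map (\<lambda>x. bool_tree (x \<in> set (take i us))) us =
      map (\<lambda>j. bool_tree (j < i)) [0..<length us]"
    by (intro nth_equalityI) auto
  then show ?thesis by (simp add: set_tree_def)
qed

definition check_cost :: "nat \<Rightarrow> nat \<Rightarrow> nat \<Rightarrow> nat" where
  "check_cost B k m = (B + 60) * (k + m + 2) + 60"

text \<open>\<open>3 * B\<close> pays for encoding both plans and one comparison of codes, the rest
  for the comparisons of task sets.\<close>

definition le_cost :: "nat \<Rightarrow> nat \<Rightarrow> nat" where
  "le_cost B k = 3 * B + 300 * (k + 1)"

text \<open>The summands belong to the unary addition, the new user set, the candidates and the sort
  at depth at most \<open>n * k\<close>; 300 is slack. The factor 2 absorbs a \<open>+ 1\<close> in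
  the number of extensions.\<close>

definition level_cost :: "nat \<Rightarrow> nat \<Rightarrow> nat \<Rightarrow> nat \<Rightarrow> nat" where
  "level_cost B n k m = 20 * (k + 1) + 30 * (n + 1) +
     2 * (200 * (k + 1) + 2 * check_cost B k m + 200) + (4 * le_cost B k + 500) * (n * k + 1) + 300"

definition solve_cost :: "nat \<Rightarrow> nat \<Rightarrow> nat \<Rightarrow> nat \<Rightarrow> nat" where
  "solve_cost B n k m = n * level_cost B n k m + 2 * check_cost B k m + 30 * (n + 1) +
     120 * (k + 1) + 500"

text \<open>The program is already fixed in \<open>solver\<close>; the instance, its description and
  its encoding enter only here, which keeps the solver uniform.\<close>

locale wsp_solver = solver P ix fa fc fe fo
  for P ix fa fc fe fo +
  fixes ss :: "'s list" and us :: "'u list" and cs :: "('s, 'u) wsp_constraint list"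
    and A :: "'s \<Rightarrow> 'u set" and R :: "(('s, 'u) plan \<times> ('s, 'u) plan) set"
    and D :: tree and enc :: "('s, 'u) plan \<Rightarrow> tree" and B :: nat
  assumes distinct_ss: "distinct ss" and distinct_us: "distinct us"
    and checkable: "checkable_within P fa fc B D ss us cs A"
    and encoding: "encoding_within P fe fo B D ss us (set cs) R enc"
    and indist: "plan_indistinguishability (set ss) (set us) (set cs) R"
begin

abbreviation "valid_plan \<equiv> valid (set ss) (set us) A (set cs)"
abbreviation "eligible_plan \<equiv> eligible (set ss) (set us) (set cs)"
abbreviation "pt \<equiv> plan_tree ss us"
abbreviation "I \<equiv> instance_tree D ss us cs"

lemma computes_check:
  assumes \<pi>: "is_plan (set ss) (set us) \<pi>"
  shows "computes_within P (ix Check) (Node I (pt \<pi>)) (bool_tree (valid_plan \<pi>))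
     (check_cost B (length ss) (length cs))"
proof -
  have a: "authorized A \<pi> \<longleftrightarrow> (\<forall>s\<in>set ss. \<forall>u. snd \<pi> s = Some u \<longrightarrow> u \<in> A s)"
    using \<pi> by (fastforce simp: authorized_def is_plan_def dom_def)
  have e: "eligible_plan \<pi> \<longleftrightarrow> (\<forall>i<length cs. satisfies \<pi> (cs ! i))"
    using \<pi> by (simp add: eligible_def all_set_conv_all_nth)
  have "computes_within P fa (Node D (Node (num_tree (0 + j)) (user_tree us u)))
      (bool_tree (u \<in> A (ss ! j))) B" if "j < length ss" "snd \<pi> (ss ! j) = Some u" for j u
  proof -
    have "u \<in> set us"
      using \<pi> ranI[of "snd \<pi>", OF that(2)] unfolding is_plan_def by blast
    from user_tree_num[OF this] obtain l where l: "l < length us" "us ! l = u"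
      "user_tree us u = num_tree l"
      by blast
    have "computes_within P fa (Node D (Node (num_tree j) (num_tree l)))
        (bool_tree (us ! l \<in> A (ss ! j))) B"
      using checkable that(1) l(1) unfolding checkable_within_def by blast
    then show ?thesis by (simp add: l)
  qed
  then have auth: "computes_within P (ix Authorized) (Node D (Node (num_tree 0) (row us ss (snd \<pi>))))
      (bool_tree (authorized A \<pi>)) ((B + 60) * (length ss + 1))"
    unfolding a by (rule computes_authorized)
  have "computes_within P fc (Node D (Node (num_tree i) (pt \<pi>)))
      (bool_tree (satisfies \<pi> (cs ! i))) B" if "i < length cs" for i
    using checkable that \<pi> unfolding checkable_within_def by blast
  then have cons: "computes_within P (ix Constraints) (Node D (Node (num_tree (length cs)) (pt \<pi>)))
      (bool_tree (eligible_plan \<pi>)) ((B + 60) * (length cs + 1))"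
    unfolding e by (rule computes_constraints)
  show ?thesis
    unfolding unfold_call instance_tree_def valid_def check_cost_def
    using computes_withinD[OF auth] computes_withinD[OF cons]
    by (cases "authorized A \<pi>") (simp_all add: plan_tree_row algebra_simps bool_tree_def)
qed

text \<open>An encoding merely asserts that some order exists for each \<open>X\<close> and
  \<open>T\<close>; a choice turns these into one function that a relation on plans can refer
  to.\<close>

definition code_order :: "'u set \<Rightarrow> 's set \<Rightarrow> (tree \<times> tree) set" where
  "code_order X T = (SOME r.
     let \<Pi> = eligible_plans (set ss) (set us) (set cs) X T in
     linear_order_on (enc ` \<Pi>) r \<and>
     (\<forall>a\<in>enc ` \<Pi>. \<forall>b\<in>enc ` \<Pi>.
        computes_within P fo (Node D (Node (set_tree us X) (Node (set_tree ss T) (Node a b))))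
          (bool_tree ((a, b) \<in> r)) B))"

lemma code_order:
  assumes "X \<subseteq> set us" "T \<subseteq> set ss"
  defines "\<Pi> \<equiv> eligible_plans (set ss) (set us) (set cs) X T"
  shows "linear_order_on (enc ` \<Pi>) (code_order X T)"
    and "a \<in> enc ` \<Pi> \<Longrightarrow> b \<in> enc ` \<Pi> \<Longrightarrow>
      computes_within P fo (Node D (Node (set_tree us X) (Node (set_tree ss T) (Node a b))))
        (bool_tree ((a, b) \<in> code_order X T)) B"
    and "\<pi>\<^sub>1 \<in> \<Pi> \<Longrightarrow> \<pi>\<^sub>2 \<in> \<Pi> \<Longrightarrow> enc \<pi>\<^sub>1 = enc \<pi>\<^sub>2 \<longleftrightarrow> (\<pi>\<^sub>1, \<pi>\<^sub>2) \<in> R"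
    and "\<pi>\<^sub>1 \<in> \<Pi> \<Longrightarrow> computes_within P fe (Node D (pt \<pi>\<^sub>1)) (enc \<pi>\<^sub>1) B"
proof -
  note e = encoding[unfolded encoding_within_def, rule_format, OF conjI[OF assms(1,2)],
      unfolded Let_def, folded \<Pi>_def]
  have "linear_order_on (enc ` \<Pi>) (code_order X T) \<and>
     (\<forall>a\<in>enc ` \<Pi>. \<forall>b\<in>enc ` \<Pi>.
        computes_within P fo (Node D (Node (set_tree us X) (Node (set_tree ss T) (Node a b))))
          (bool_tree ((a, b) \<in> code_order X T)) B)"
    unfolding code_order_def Let_def \<Pi>_def[symmetric] by (rule someI_ex) (use e in blast)
  then show "linear_order_on (enc ` \<Pi>) (code_order X T)"
    and "a \<in> enc ` \<Pi> \<Longrightarrow> b \<in> enc ` \<Pi> \<Longrightarrow>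
      computes_within P fo (Node D (Node (set_tree us X) (Node (set_tree ss T) (Node a b))))
        (bool_tree ((a, b) \<in> code_order X T)) B"
    by blast+
  show "\<pi>\<^sub>1 \<in> \<Pi> \<Longrightarrow> \<pi>\<^sub>2 \<in> \<Pi> \<Longrightarrow> enc \<pi>\<^sub>1 = enc \<pi>\<^sub>2 \<longleftrightarrow> (\<pi>\<^sub>1, \<pi>\<^sub>2) \<in> R"
    and "\<pi>\<^sub>1 \<in> \<Pi> \<Longrightarrow> computes_within P fe (Node D (pt \<pi>\<^sub>1)) (enc \<pi>\<^sub>1) B"
    using e by blast+
qed

section \<open>A total preorder on the plans with a fixed user set\<close>

definition support :: "('s, 'u) plan \<Rightarrow> bool list" where
  "support \<pi> = map (\<lambda>s. snd \<pi> s \<noteq> None) ss"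

text \<open>Code comparison is specified only for plans sharing user set and task set, so the task
  set has to decide before any code is looked at.\<close>

definition plan_le :: "('s, 'u) plan \<Rightarrow> ('s, 'u) plan \<Rightarrow> bool" where
  "plan_le \<pi>\<^sub>1 \<pi>\<^sub>2 \<longleftrightarrow> support \<pi>\<^sub>1 < support \<pi>\<^sub>2 \<or>
     support \<pi>\<^sub>1 = support \<pi>\<^sub>2 \<and> (enc \<pi>\<^sub>1, enc \<pi>\<^sub>2) \<in> code_order (users \<pi>\<^sub>1) (tasks \<pi>\<^sub>1)"

definition plans_on :: "'u set \<Rightarrow> ('s, 'u) plan set" where
  "plans_on X = {\<pi>. eligible_plan \<pi> \<and> users \<pi> = X}"

lemma related_plansD:
  assumes "(\<pi>\<^sub>1, \<pi>\<^sub>2) \<in> R"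
  shows "eligible_plan \<pi>\<^sub>1" "eligible_plan \<pi>\<^sub>2" "users \<pi>\<^sub>1 = users \<pi>\<^sub>2" "tasks \<pi>\<^sub>1 = tasks \<pi>\<^sub>2"
proof -
  have "(\<pi>\<^sub>1, \<pi>\<^sub>2) \<in> ext_equiv (set ss) (set us) (set cs)"
    using assms indist unfolding plan_indistinguishability_def by blast
  then show "eligible_plan \<pi>\<^sub>1" "eligible_plan \<pi>\<^sub>2" "users \<pi>\<^sub>1 = users \<pi>\<^sub>2" "tasks \<pi>\<^sub>1 = tasks \<pi>\<^sub>2"
    unfolding ext_equiv_def by blast+
qed

lemma support_eq_iff:
  assumes "eligible_plan \<pi>\<^sub>1" "eligible_plan \<pi>\<^sub>2"
  shows "support \<pi>\<^sub>1 = support \<pi>\<^sub>2 \<longleftrightarrow> tasks \<pi>\<^sub>1 = tasks \<pi>\<^sub>2"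
proof -
  have "tasks \<pi>\<^sub>1 \<subseteq> set ss" "tasks \<pi>\<^sub>2 \<subseteq> set ss"
    using assms by (auto simp: eligible_def is_plan_def)
  moreover have "support \<pi>\<^sub>1 = support \<pi>\<^sub>2 \<longleftrightarrow> (\<forall>s\<in>set ss. s \<in> tasks \<pi>\<^sub>1 \<longleftrightarrow> s \<in> tasks \<pi>\<^sub>2)"
    unfolding support_def by (simp add: domIff)
  ultimately show ?thesis by blast
qed

lemma mem_eligible_plans:
  assumes "\<pi> \<in> plans_on X"
  shows "\<pi> \<in> eligible_plans (set ss) (set us) (set cs) X (tasks \<pi>)" "X \<subseteq> set us"
    "tasks \<pi> \<subseteq> set ss"
  using assms by (auto simp: plans_on_def eligible_plans_def eligible_def is_plan_def)

text \<open>Antisymmetry turns comparison in both directions into equality of codes, which the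
  encoding identifies with \<open>R\<close>.\<close>

lemma same_tasks_code_order:
  assumes "\<pi>\<^sub>1 \<in> plans_on X" "\<pi>\<^sub>2 \<in> plans_on X" "tasks \<pi>\<^sub>1 = tasks \<pi>\<^sub>2"
  shows "(enc \<pi>\<^sub>1, enc \<pi>\<^sub>2) \<in> code_order X (tasks \<pi>\<^sub>1) \<or> (enc \<pi>\<^sub>2, enc \<pi>\<^sub>1) \<in> code_order X (tasks \<pi>\<^sub>1)"
    and "(enc \<pi>\<^sub>1, enc \<pi>\<^sub>2) \<in> code_order X (tasks \<pi>\<^sub>1) \<Longrightarrow>
      (enc \<pi>\<^sub>2, enc \<pi>\<^sub>1) \<in> code_order X (tasks \<pi>\<^sub>1) \<Longrightarrow> (\<pi>\<^sub>1, \<pi>\<^sub>2) \<in> R"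
    and "(\<pi>\<^sub>1, \<pi>\<^sub>2) \<in> R \<Longrightarrow> enc \<pi>\<^sub>1 = enc \<pi>\<^sub>2"
proof -
  note m1 = mem_eligible_plans[OF assms(1)] and m2 = mem_eligible_plans[OF assms(2), folded assms(3)]
  note c = code_order[OF m1(2,3)]
  note lin = c(1)[unfolded linear_order_on_def partial_order_on_def preorder_on_def]
  have mem: "enc \<pi>\<^sub>1 \<in> enc ` eligible_plans (set ss) (set us) (set cs) X (tasks \<pi>\<^sub>1)"
    "enc \<pi>\<^sub>2 \<in> enc ` eligible_plans (set ss) (set us) (set cs) X (tasks \<pi>\<^sub>1)"
    using m1 m2 by auto
  show "(enc \<pi>\<^sub>1, enc \<pi>\<^sub>2) \<in> code_order X (tasks \<pi>\<^sub>1) \<or> (enc \<pi>\<^sub>2, enc \<pi>\<^sub>1) \<in> code_order X (tasks \<pi>\<^sub>1)"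
    using lin mem unfolding total_on_def refl_on_def by metis
  show "(\<pi>\<^sub>1, \<pi>\<^sub>2) \<in> R" if "(enc \<pi>\<^sub>1, enc \<pi>\<^sub>2) \<in> code_order X (tasks \<pi>\<^sub>1)"
    "(enc \<pi>\<^sub>2, enc \<pi>\<^sub>1) \<in> code_order X (tasks \<pi>\<^sub>1)"
    using lin that c(3)[OF m1(1) m2(1)] unfolding antisym_def by blast
  show "enc \<pi>\<^sub>1 = enc \<pi>\<^sub>2" if "(\<pi>\<^sub>1, \<pi>\<^sub>2) \<in> R"
    using that c(3)[OF m1(1) m2(1)] by blast
qed

lemma plan_le_total:
  assumes "\<pi>\<^sub>1 \<in> plans_on X" "\<pi>\<^sub>2 \<in> plans_on X"
  shows "plan_le \<pi>\<^sub>1 \<pi>\<^sub>2 \<or> plan_le \<pi>\<^sub>2 \<pi>\<^sub>1"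
proof -
  have u: "users \<pi>\<^sub>1 = X" "users \<pi>\<^sub>2 = X" and e: "eligible_plan \<pi>\<^sub>1" "eligible_plan \<pi>\<^sub>2"
    using assms by (auto simp: plans_on_def)
  show ?thesis
    using same_tasks_code_order(1)[OF assms] support_eq_iff[OF e] u
    unfolding plan_le_def by (metis linorder_neqE)
qed

lemma plan_le_trans:
  assumes "\<pi>\<^sub>1 \<in> plans_on X" "\<pi>\<^sub>2 \<in> plans_on X" "\<pi>\<^sub>3 \<in> plans_on X"
    and le: "plan_le \<pi>\<^sub>1 \<pi>\<^sub>2" "plan_le \<pi>\<^sub>2 \<pi>\<^sub>3"
  shows "plan_le \<pi>\<^sub>1 \<pi>\<^sub>3"
proof (cases "support \<pi>\<^sub>1 = support \<pi>\<^sub>2 \<and> support \<pi>\<^sub>2 = support \<pi>\<^sub>3")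
  case True
  have u: "users \<pi>\<^sub>1 = X" "users \<pi>\<^sub>2 = X" "users \<pi>\<^sub>3 = X"
    and e: "eligible_plan \<pi>\<^sub>1" "eligible_plan \<pi>\<^sub>2" "eligible_plan \<pi>\<^sub>3"
    using assms by (auto simp: plans_on_def)
  have "tasks \<pi>\<^sub>1 = tasks \<pi>\<^sub>2" "tasks \<pi>\<^sub>2 = tasks \<pi>\<^sub>3"
    using True support_eq_iff e by blast+
  moreover have "trans (code_order X (tasks \<pi>\<^sub>1))"
    using code_order(1)[OF mem_eligible_plans(2,3)[OF assms(1)]]
    by (simp add: linear_order_on_def partial_order_on_def preorder_on_def)
  ultimately show ?thesis
    using True le u unfolding plan_le_def by (auto dest: transD)
next
  case False
  then show ?thesis
    using le unfolding plan_le_def by (metis less_trans)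
qed

text \<open>Makes a sort that drops ties a selection of one plan per class: ties have equal
  supports, so codes decide, and related plans share their task set.\<close>

lemma plan_le_antisym_iff:
  assumes "\<pi>\<^sub>1 \<in> plans_on X" "\<pi>\<^sub>2 \<in> plans_on X"
  shows "plan_le \<pi>\<^sub>1 \<pi>\<^sub>2 \<and> plan_le \<pi>\<^sub>2 \<pi>\<^sub>1 \<longleftrightarrow> (\<pi>\<^sub>1, \<pi>\<^sub>2) \<in> R"
proof -
  have u: "users \<pi>\<^sub>1 = X" "users \<pi>\<^sub>2 = X" and e: "eligible_plan \<pi>\<^sub>1" "eligible_plan \<pi>\<^sub>2"
    using assms by (auto simp: plans_on_def)
  note s = support_eq_iff[OF e]
  show ?thesis
  proof
    assume le: "plan_le \<pi>\<^sub>1 \<pi>\<^sub>2 \<and> plan_le \<pi>\<^sub>2 \<pi>\<^sub>1"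
    then have "support \<pi>\<^sub>1 = support \<pi>\<^sub>2"
      unfolding plan_le_def by auto
    then show "(\<pi>\<^sub>1, \<pi>\<^sub>2) \<in> R"
      using le s u same_tasks_code_order(2)[OF assms] unfolding plan_le_def by auto
  next
    assume R: "(\<pi>\<^sub>1, \<pi>\<^sub>2) \<in> R"
    then have t: "tasks \<pi>\<^sub>1 = tasks \<pi>\<^sub>2"
      by (rule related_plansD)
    have "enc \<pi>\<^sub>1 = enc \<pi>\<^sub>2"
      using same_tasks_code_order(3)[OF assms t R] .
    then show "plan_le \<pi>\<^sub>1 \<pi>\<^sub>2 \<and> plan_le \<pi>\<^sub>2 \<pi>\<^sub>1"
      using same_tasks_code_order(1)[OF assms t] t s u unfolding plan_le_def by auto
  qed
qed

lemma computes_le: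
  assumes "\<pi>\<^sub>1 \<in> plans_on X" "\<pi>\<^sub>2 \<in> plans_on X"
  shows "computes_within P (ix Le) (Node D (Node (pt \<pi>\<^sub>1) (pt \<pi>\<^sub>2))) (bool_tree (plan_le \<pi>\<^sub>1 \<pi>\<^sub>2))
     (le_cost B (length ss))"
proof -
  have u: "users \<pi>\<^sub>1 = X" "users \<pi>\<^sub>2 = X" and e: "eligible_plan \<pi>\<^sub>1" "eligible_plan \<pi>\<^sub>2"
    using assms by (auto simp: plans_on_def)
  note m1 = mem_eligible_plans[OF assms(1)] and m2 = mem_eligible_plans[OF assms(2)]
  note less = computes_withinD[OF computes_less[of us ss "snd \<pi>\<^sub>1" "snd \<pi>\<^sub>2", folded support_def]]
    computes_withinD[OF computes_less[of us ss "snd \<pi>\<^sub>2" "snd \<pi>\<^sub>1", folded support_def]]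
  note supp = computes_withinD[OF computes_support[of us ss "snd \<pi>\<^sub>1"]]
  consider "support \<pi>\<^sub>1 < support \<pi>\<^sub>2" | "support \<pi>\<^sub>2 < support \<pi>\<^sub>1" | "support \<pi>\<^sub>1 = support \<pi>\<^sub>2"
    by (rule linorder_less_linear[THEN disjE]) auto
  then show ?thesis
  proof cases
    case 1
    show ?thesis unfolding unfold_call plan_le_def le_cost_def plan_tree_row
      using less 1 by (simp add: bool_tree_def)
  next
    case 2
    then have "\<not> support \<pi>\<^sub>1 < support \<pi>\<^sub>2" "support \<pi>\<^sub>1 \<noteq> support \<pi>\<^sub>2"
      by auto
    then show ?thesis unfolding unfold_call plan_le_def le_cost_def plan_tree_row
      using less 2 by (simp add: bool_tree_def)
  next
    case 3
    then have t: "tasks \<pi>\<^sub>2 = tasks \<pi>\<^sub>1"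
      using support_eq_iff[OF e] by simp
    note c = code_order[OF m1(2,3)]
    have "computes_within P fo
        (Node D (Node (set_tree us X) (Node (set_tree ss (tasks \<pi>\<^sub>1)) (Node (enc \<pi>\<^sub>1) (enc \<pi>\<^sub>2)))))
        (bool_tree ((enc \<pi>\<^sub>1, enc \<pi>\<^sub>2) \<in> code_order X (tasks \<pi>\<^sub>1))) B"
      using m1(1) m2(1) t by (intro c(2)) auto
    note fo = computes_withinD[OF this]
    note fe = computes_withinD[OF c(4)[OF m1(1)]] computes_withinD[OF c(4)[OF m2(1)[unfolded t]]]
    show ?thesis unfolding unfold_call plan_le_def le_cost_def
      using less supp fo fe[unfolded plan_tree_row] 3 u by (simp add: plan_tree_row)
  qed
qed

section \<open>The table of a level and its invariant\<close>

abbreviation "U i \<equiv> set (take i us)"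

definition candidates :: "nat \<Rightarrow> ('s, 'u) plan list \<Rightarrow> ('s, 'u) plan list" where
  "candidates i \<pi>s = map (\<lambda>g. (U (Suc i), g)) (filter (\<lambda>g. valid_plan (U (Suc i), g))
     (concat (map (\<lambda>\<pi>. extensions (us ! i) ss (snd \<pi>)) \<pi>s)))"

definition step :: "nat \<Rightarrow> ('s, 'u) plan list \<Rightarrow> ('s, 'u) plan list" where
  "step i \<pi>s = msort plan_le (Suc i * length ss) (candidates i \<pi>s)"

text \<open>Both the stored and the covered plans are valid, not just eligible, since
  \<open>R\<close> does not see authorization. The length bound guarantees that the depth of the
  next sort is sufficient.\<close>

definition represents :: "nat \<Rightarrow> ('s, 'u) plan list \<Rightarrow> bool" where
  "represents i \<pi>s \<longleftrightarrow>
     distinct \<pi>s \<and> length \<pi>s \<le> 2 ^ (i * length ss) \<and>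
     (\<forall>\<pi>\<in>set \<pi>s. valid_plan \<pi> \<and> users \<pi> = U i) \<and>
     (\<forall>\<pi>\<in>set \<pi>s. \<forall>\<pi>'\<in>set \<pi>s. (\<pi>, \<pi>') \<in> R \<longrightarrow> \<pi> = \<pi>') \<and>
     (\<forall>\<pi>. valid_plan \<pi> \<and> users \<pi> = U i \<longrightarrow> (\<exists>\<pi>'\<in>set \<pi>s. (\<pi>, \<pi>') \<in> R))"

lemma equiv_R: "equiv {\<pi>. eligible_plan \<pi>} R"
  using indist by (simp add: plan_indistinguishability_def)

lemma R_refl: "eligible_plan \<pi> \<Longrightarrow> (\<pi>, \<pi>) \<in> R"
  using equiv_R unfolding equiv_def refl_on_def by blast

lemma R_trans: "(\<pi>\<^sub>1, \<pi>\<^sub>2) \<in> R \<Longrightarrow> (\<pi>\<^sub>2, \<pi>\<^sub>3) \<in> R \<Longrightarrow> (\<pi>\<^sub>1, \<pi>\<^sub>3) \<in> R"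
  using equiv_R by (meson equiv_def transD)

text \<open>Removing the tasks of the last user from a valid plan leaves a valid plan, which may be
  replaced by an equivalent one before the last user is added again.\<close>

lemma represents_extend:
  assumes rep: "represents i \<pi>s" and i: "i < length us"
    and \<pi>: "valid_plan \<pi>" "users \<pi> = U (Suc i)"
  shows "\<exists>\<pi>'\<in>set (candidates i \<pi>s). (\<pi>, \<pi>') \<in> R"
proof -
  define u where "u = us ! i"
  define f where "f = snd \<pi>"
  define T where "T = {s. f s = Some u}"
  define f0 where "f0 = f |` (- T)"
  define f1 where "f1 = f |` T"
  have U: "U (Suc i) = insert u (U i)"
    using i by (simp add: take_Suc_conv_app_nth u_def)
  have u: "u \<notin> U i" "u \<in> set us"
    using i distinct_us by (auto simp: u_def in_set_conv_nth nth_eq_iff_index_eq)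
  have plan: "is_plan (set ss) (set us) \<pi>" and sat: "\<And>c. c \<in> set cs \<Longrightarrow> satisfies \<pi> c"
    and auth: "authorized A \<pi>"
    using \<pi>(1) by (auto simp: valid_def eligible_def)
  have dom: "dom f \<subseteq> set ss" and ran: "ran f \<subseteq> insert u (U i)"
    using plan \<pi>(2) U by (auto simp: is_plan_def f_def)
  have dom0: "dom f0 = dom f - T" and dom1: "dom f1 = T"
    by (auto simp: f0_def f1_def T_def)
  have ran0: "ran f0 \<subseteq> U i"
  proof
    fix x
    assume "x \<in> ran f0"
    then obtain s where "f0 s = Some x"
      by (auto simp: ran_def)
    then have "f s = Some x" "x \<noteq> u"
      by (auto simp: f0_def T_def restrict_map_def split: if_splits)
    with ranI[of f s x] ran show "x \<in> U i" by auto
  qed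
  have ran1: "ran f1 \<subseteq> {u}"
    by (auto simp: f1_def T_def ran_def restrict_map_def split: if_splits)
  have plan0: "is_plan (set ss) (set us) (U i, f0)"
    using dom dom0 ran0 set_take_subset[of i us] by (auto simp: is_plan_def)
  \<comment> \<open>The user \<open>u\<close> is included even if \<open>T\<close> is empty, so that
    the union has user set \<open>U (Suc i)\<close>. Closure of \<open>R\<close> under unions asks
    only for a plan here, not for an eligible one.\<close>
  have plan1: "is_plan (set ss) (set us) ({u}, f1)"
    using dom dom1 ran1 u by (auto simp: is_plan_def T_def)
  \<comment> \<open>Restriction keeps constraints satisfied: either the scope leaves the smaller
    domain, or the two maps agree on it.\<close>
  have "satisfies (U i, f0) c" if "c \<in> set cs" for c
  proof (cases "fst c \<subseteq> dom f0")
    case True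
    then have "f0 |` fst c = f |` fst c"
      unfolding dom0 f0_def by (auto simp: restrict_map_def fun_eq_iff)
    moreover have "f |` fst c \<in> snd c"
      using sat[OF that] True dom0 unfolding satisfies_def f_def by blast
    ultimately show ?thesis by (simp add: satisfies_def)
  next
    case False
    then show ?thesis by (auto simp: satisfies_def)
  qed
  moreover have "authorized A (U i, f0)"
    using auth by (auto simp: authorized_def f0_def f_def restrict_map_def split: if_splits)
  ultimately have "valid_plan (U i, f0)"
    using plan0 by (simp add: valid_def eligible_def)
  then obtain \<pi>' where \<pi>': "\<pi>' \<in> set \<pi>s" "((U i, f0), \<pi>') \<in> R"
    using rep unfolding represents_def by fastforce
  define g where "g = snd \<pi>'"
  have \<pi>'_eq: "\<pi>' = (U i, g)" and domg: "dom g = dom f - T"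
    using related_plansD(3,4)[OF \<pi>'(2)] dom0 by (auto simp: g_def prod_eq_iff)
  have disj: "disjoint_plans (U i, f0) ({u}, f1)" "disjoint_plans \<pi>' ({u}, f1)"
    using dom0 dom1 domg u by (auto simp: disjoint_plans_def \<pi>'_eq)
  have union: "plan_union (U i, f0) ({u}, f1) = \<pi>"
  proof -
    have "f0 ++ f1 = f"
      by (auto simp: fun_eq_iff map_add_def f0_def f1_def restrict_map_def split: option.split)
    then show ?thesis
      using \<pi>(2) U by (simp add: plan_union_def f_def prod_eq_iff)
  qed
  have "eligible_plan \<pi>"
    using \<pi>(1) by (simp add: valid_def)
  \<comment> \<open>Both plans are extended by the same disjoint plan, which gives the tasks in
    \<open>T\<close> to \<open>u\<close>; on the left this restores \<pi>.\<close>
  then have R: "(\<pi>, plan_union \<pi>' ({u}, f1)) \<in> R"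
    using indist \<pi>'(2) plan1 disj union unfolding plan_indistinguishability_def by metis
  have eq: "plan_union \<pi>' ({u}, f1) = (U (Suc i), g ++ f1)"
    using U by (simp add: plan_union_def \<pi>'_eq)
  have f1: "f1 s = (if s \<in> T then Some u else None)" for s
    by (simp add: f1_def T_def restrict_map_def)
  have "g ++ f1 \<in> set (extensions u ss g)"
    unfolding set_extensions
  proof
    fix s
    show "(g ++ f1) s = g s \<or> g s = None \<and> s \<in> set ss \<and> (g ++ f1) s = Some u"
    proof (cases "s \<in> T")
      case True
      then have "g s = None" "s \<in> set ss"
        using domg dom by (auto simp: T_def)
      with True show ?thesis by (simp add: map_add_def f1)
    qed (simp add: map_add_def f1)
  qed
  \<comment> \<open>\<open>R\<close> transfers eligibility only. Authorization is checked task by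
    task: on \<open>T\<close> it comes from \<pi>, elsewhere from the representative.\<close>
  moreover have "valid_plan (U (Suc i), g ++ f1)"
  proof -
    have "authorized A (U (Suc i), g ++ f1)"
      unfolding authorized_def
    proof
      fix s
      assume s: "s \<in> tasks (U (Suc i), g ++ f1)"
      show "the (snd (U (Suc i), g ++ f1) s) \<in> A s"
      proof (cases "s \<in> T")
        case True
        then have "s \<in> tasks \<pi>" "the (snd \<pi> s) = u"
          by (auto simp: T_def f_def)
        with True auth show ?thesis by (auto simp: authorized_def map_add_def f1)
      next
        case False
        with s have "s \<in> dom g"
          by (auto simp: map_add_def f1)
        moreover have "authorized A \<pi>'"
          using rep \<pi>'(1) by (auto simp: represents_def valid_def)
        ultimately show ?thesis
          using False by (auto simp: authorized_def map_add_def f1 \<pi>'_eq)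
      qed
    qed
    then show ?thesis
      using related_plansD(2)[OF R] eq by (simp add: valid_def)
  qed
  ultimately have "(U (Suc i), g ++ f1) \<in> set (candidates i \<pi>s)"
    using \<pi>'(1) unfolding candidates_def u_def g_def by auto
  with R show ?thesis unfolding eq by blast
qed

lemma set_candidates: "set (candidates i \<pi>s) \<subseteq> plans_on (U (Suc i))"
proof
  fix \<pi>
  assume "\<pi> \<in> set (candidates i \<pi>s)"
  then obtain g where "\<pi> = (U (Suc i), g)" "valid_plan (U (Suc i), g)"
    unfolding candidates_def by auto
  then show "\<pi> \<in> plans_on (U (Suc i))"
    by (simp add: plans_on_def valid_def)
qed

lemma length_candidates_le:
  "length (candidates i \<pi>s) \<le> length (concat (map (\<lambda>\<pi>. extensions (us ! i) ss (snd \<pi>)) \<pi>s))"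
  by (simp add: candidates_def)

lemma length_extensions_concat:
  "length (concat (map (\<lambda>\<pi>. extensions u ss (snd \<pi>)) \<pi>s)) =
     (\<Sum>\<pi>\<leftarrow>\<pi>s. 2 ^ card (set ss - tasks \<pi>))"
  by (simp add: length_concat comp_def length_extensions[OF distinct_ss])

text \<open>A user multiplies the number of plans by at most \<open>2 ^ k\<close>. This crude bound
  serves the sort depth only: unlike the width, it can be tracked by the program.\<close>

lemma length_candidates_le_power:
  assumes "length \<pi>s \<le> 2 ^ (i * length ss)"
  shows "length (candidates i \<pi>s) \<le> 2 ^ (Suc i * length ss)"
proof -
  have card: "card (set ss - tasks \<pi>) \<le> length ss" for \<pi> :: "('s, 'u) plan"
    by (meson List.finite_set card_Diff_subset_Int card_length card_mono Diff_subset le_trans)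
  have "length (candidates i \<pi>s) \<le> (\<Sum>\<pi>\<leftarrow>\<pi>s. 2 ^ card (set ss - tasks \<pi>))"
    using length_candidates_le[of i \<pi>s] by (simp only: length_extensions_concat)
  also have "\<dots> \<le> (\<Sum>\<pi>\<leftarrow>\<pi>s. 2 ^ length ss)"
    using card by (intro sum_list_mono power_increasing) auto
  also have "\<dots> = length \<pi>s * 2 ^ length ss"
    by (simp add: sum_list_triv)
  also have "\<dots> \<le> 2 ^ (i * length ss) * 2 ^ length ss"
    using assms by (rule mult_le_mono1)
  also have "\<dots> = 2 ^ (Suc i * length ss)"
    by (simp add: power_add)
  finally show ?thesis .
qed

lemma represents_step:
  assumes rep: "represents i \<pi>s" and i: "i < length us"
  shows "represents (Suc i) (step i \<pi>s)"
proof -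
  let ?c = "candidates i \<pi>s" and ?d = "Suc i * length ss" and ?Q = "plans_on (U (Suc i))"
  have len: "length ?c \<le> 2 ^ ?d"
    using rep by (intro length_candidates_le_power) (simp add: represents_def)
  have sorted: "sorted_wrt (\<lambda>x y. plan_le x y \<and> \<not> plan_le y x) (step i \<pi>s)"
    unfolding step_def
    by (rule msort_sorted[where A = ?Q]) (fact plan_le_total plan_le_trans set_candidates)+
  have sub: "set (step i \<pi>s) \<subseteq> set ?c"
    unfolding step_def by (rule set_msort)
  have Q: "\<pi> \<in> ?Q" if "\<pi> \<in> set (step i \<pi>s)" for \<pi>
    using that sub set_candidates[of i \<pi>s] by blast
  have "distinct (step i \<pi>s)"
    using sorted by (rule sorted_wrt_distinct) simp
  moreover have "length (step i \<pi>s) \<le> 2 ^ ?d"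
    using length_msort[of plan_le ?d ?c] by (simp add: step_def)
  moreover have "valid_plan \<pi> \<and> users \<pi> = U (Suc i)" if "\<pi> \<in> set (step i \<pi>s)" for \<pi>
    using that sub by (auto simp: candidates_def)
  moreover have "\<pi> = \<pi>'" if "\<pi> \<in> set (step i \<pi>s)" "\<pi>' \<in> set (step i \<pi>s)" "(\<pi>, \<pi>') \<in> R" for \<pi> \<pi>'
    using sorted_wrt_trichotomy[OF sorted that(1,2)] plan_le_antisym_iff[OF Q Q] that by blast
  moreover have "\<exists>\<pi>'\<in>set (step i \<pi>s). (\<pi>, \<pi>') \<in> R"
    if \<pi>: "valid_plan \<pi>" "users \<pi> = U (Suc i)" for \<pi>
  proof -
    obtain \<pi>1 where \<pi>1: "\<pi>1 \<in> set ?c" "(\<pi>, \<pi>1) \<in> R"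
      using represents_extend[OF rep i \<pi>] by blast
    have "\<exists>\<pi>'\<in>set (msort plan_le ?d ?c). plan_le \<pi>1 \<pi>' \<and> plan_le \<pi>' \<pi>1"
    proof (rule msort_covers[where A = ?Q])
      \<comment> \<open>The sort reads \<open>2 ^ d\<close> elements, which by \<open>len\<close> is
        the whole list.\<close>
      show "\<pi>1 \<in> set (take (2 ^ ?d) ?c)"
        using \<pi>1(1) len by simp
    qed (fact plan_le_total plan_le_trans set_candidates)+
    then obtain \<pi>' where \<pi>': "\<pi>' \<in> set (step i \<pi>s)" "plan_le \<pi>1 \<pi>'" "plan_le \<pi>' \<pi>1"
      by (auto simp: step_def)
    have "(\<pi>1, \<pi>') \<in> R"
      using plan_le_antisym_iff[OF subsetD[OF set_candidates \<pi>1(1)] Q[OF \<pi>'(1)]] \<pi>' by blast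
    with R_trans[OF \<pi>1(2)] \<pi>'(1) show ?thesis by blast
  qed
  ultimately show ?thesis
    unfolding represents_def by blast
qed

lemma plan_without_users:
  assumes "eligible_plan \<pi>" "users \<pi> = {}"
  shows "\<pi> = ({}, Map.empty)"
proof -
  have "ran (snd \<pi>) = {}"
    using assms by (auto simp: eligible_def is_plan_def)
  then have "snd \<pi> s = None" for s
    by (cases "snd \<pi> s") (auto dest: ranI)
  with assms(2) show ?thesis by (auto simp: prod_eq_iff)
qed

text \<open>The filter matters: a constraint with empty scope can reject even the empty plan, and
  then the table is empty.\<close>

lemma represents_0: "represents 0 (filter valid_plan [({}, Map.empty)])"
proof -
  have cover: "\<exists>\<pi>'\<in>set (filter valid_plan [({}, Map.empty)]). (\<pi>, \<pi>') \<in> R"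
    if "valid_plan \<pi>" "users \<pi> = U 0" for \<pi>
  proof -
    have "eligible_plan \<pi>"
      using that(1) by (simp add: valid_def)
    moreover from this have "\<pi> = ({}, Map.empty)"
      by (rule plan_without_users) (use that(2) in simp)
    ultimately show ?thesis
      using that(1) R_refl by auto
  qed
  show ?thesis
    unfolding represents_def by (intro conjI allI impI; (elim conjE, rule cover)?) auto
qed

section \<open>Number of extensions of a level and the cost of producing them\<close>

lemma sum_free_tasks_width:
  assumes rep: "represents i \<pi>s" and i: "i \<le> length us"
  shows "(\<Sum>\<pi>\<leftarrow>\<pi>s. 2 ^ card (set ss - tasks \<pi>)) \<le>
      max 2 (width (set ss) us (set cs) R) * 3 ^ length ss"
proof -
  have el: "eligible_plan \<pi>" "users \<pi> = U i" if "\<pi> \<in> set \<pi>s" for \<pi>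
    using rep that by (auto simp: represents_def valid_def)
  have "card {\<pi> \<in> set \<pi>s. tasks \<pi> = T} \<le> max 2 (width (set ss) us (set cs) R)"
    if T: "T \<subseteq> set ss" for T
  proof (cases "i = 0")
    \<comment> \<open>The width ranges over \<open>i \<ge> 1\<close>. Level 0 contains at most the
      empty plan, for which \<open>max 2\<close> leaves room.\<close>
    case True
    have "{\<pi> \<in> set \<pi>s. tasks \<pi> = T} \<subseteq> {({}, Map.empty)}"
      using plan_without_users[OF el(1)] el(2) True by auto
    from card_mono[OF _ this] show ?thesis by simp
  next
    case False
    have "card {\<pi> \<in> set \<pi>s. tasks \<pi> = T} \<le> width (set ss) us (set cs) R"
      by (rule card_inequivalent_le_width[OF _ equiv_R, where i = i and T = T])
        (use el rep False i T in \<open>auto simp: eligible_plans_def represents_def\<close>)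
    then show ?thesis by simp
  qed
  moreover have "tasks \<pi> \<subseteq> set ss" if "\<pi> \<in> set \<pi>s" for \<pi>
    using el[OF that] by (simp add: eligible_def is_plan_def)
  moreover have "distinct \<pi>s"
    using rep by (simp add: represents_def)
  ultimately show ?thesis
    using sum_free_tasks_le[of "set ss" \<pi>s] by (simp add: distinct_card[OF distinct_ss])
qed

lemma is_plan_extension:
  assumes \<pi>: "is_plan (set ss) (set us) \<pi>" "users \<pi> = U i" and i: "i < length us"
    and g: "g \<in> set (extensions (us ! i) ss (snd \<pi>))"
  shows "is_plan (set ss) (set us) (U (Suc i), g)"
proof -
  have *: "g s = snd \<pi> s \<or> s \<in> set ss \<and> g s = Some (us ! i)" for s
    using g unfolding set_extensions by blast
  have U: "U (Suc i) = insert (us ! i) (U i)"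
    using i by (simp add: take_Suc_conv_app_nth)
  have "dom g \<subseteq> set ss"
  proof
    fix s
    assume "s \<in> dom g"
    then show "s \<in> set ss"
      using *[of s] \<pi>(1) unfolding is_plan_def by (metis domIff subsetD)
  qed
  moreover have "ran g \<subseteq> U (Suc i)"
  proof
    fix u
    assume "u \<in> ran g"
    then obtain s where s: "g s = Some u"
      by (auto simp: ran_def)
    show "u \<in> U (Suc i)"
    proof (cases "u = us ! i")
      case False
      then have "u \<in> ran (snd \<pi>)"
        using *[of s] s by (metis option.inject ranI)
      then show ?thesis
        using \<pi> U unfolding is_plan_def by blast
    qed (simp add: U)
  qed
  ultimately show ?thesis
    using set_take_subset[of "Suc i" us] by (simp add: is_plan_def)
qed

lemma computes_candidates_plans:
  assumes rep: "represents i \<pi>s" and i: "i < length us"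
  shows "computes_within P (ix Candidates)
     (Node (Node I (set_tree us (U (Suc i)))) (Node (num_tree (Suc i)) (list_tree (map pt \<pi>s))))
     (list_tree (map pt (candidates i \<pi>s)))
     ((200 * (length ss + 1) + 2 * check_cost B (length ss) (length cs) + 200) *
        ((\<Sum>\<pi>\<leftarrow>\<pi>s. 2 ^ card (set ss - tasks \<pi>)) + 1))"
proof -
  let ?E = "\<lambda>\<pi> :: ('s, 'u) plan. extensions (us ! i) ss (snd \<pi>)"
  \<comment> \<open>An assigned entry is a \<open>Node Leaf\<close> above the index of the user,
    which is the numeral of the successor. So the next level number doubles as the table entry for
    the new user.\<close>
  have e: "entry us (Some (us ! i)) = num_tree (Suc i)"
    by (simp add: entry_def user_tree_nth[OF distinct_us i])
  have "computes_within P (ix Candidates)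
     (Node (Node I (set_tree us (U (Suc i)))) (Node (num_tree (Suc i))
        (list_tree (map (\<lambda>\<pi>. Node (set_tree us (users \<pi>)) (row us ss (snd \<pi>))) \<pi>s))))
     (list_tree (map (\<lambda>g. Node (set_tree us (U (Suc i))) (row us ss g))
        (filter (\<lambda>g. valid_plan (U (Suc i), g)) (concat (map ?E \<pi>s)))))
     ((200 * (length ss + 1) + 2 * check_cost B (length ss) (length cs) + 200) *
        (length (concat (map ?E \<pi>s)) + 1))"
  proof (rule computes_candidates)
    fix \<pi>
    assume \<pi>: "\<pi> \<in> set \<pi>s"
    show "computes_within P (ix Extend) (Node (num_tree (Suc i)) (row us ss (snd \<pi>)))
        (list_tree (map (row us ss) (?E \<pi>))) (200 * (length ss + 1) * length (?E \<pi>))"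
      unfolding e[symmetric] by (rule computes_extend[OF distinct_ss])
    show "0 < length (?E \<pi>)"
      by simp
    fix g
    assume g: "g \<in> set (?E \<pi>)"
    have "is_plan (set ss) (set us) \<pi>" "users \<pi> = U i"
      using rep \<pi> by (auto simp: represents_def valid_def eligible_def)
    from computes_check[OF is_plan_extension[OF this i g]]
    show "computes_within P (ix Check) (Node I (Node (set_tree us (U (Suc i))) (row us ss g)))
        (bool_tree (valid_plan (U (Suc i), g))) (check_cost B (length ss) (length cs))"
      by (simp add: plan_tree_row)
  qed
  then show ?thesis
    unfolding length_extensions_concat candidates_def plan_tree_fun by (simp add: comp_def)
qed

section \<open>The complete run\<close>

abbreviation "table_bound \<equiv> max 2 (width (set ss) us (set cs) R) * 3 ^ length ss"

lemma computes_loop: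
  assumes "represents i \<pi>s" "i + r = length us"
  shows "\<exists>\<pi>s'. represents (length us) \<pi>s' \<and> computes_within P (ix Loop)
     (Node I (Node (num_tree r) (Node (num_tree i)
        (Node (num_tree (i * length ss)) (list_tree (map pt \<pi>s))))))
     (list_tree (map pt \<pi>s'))
     (r * (level_cost B (length us) (length ss) (length cs) * table_bound) + 20)"
  using assms
proof (induction r arbitrary: i \<pi>s)
  case 0
  then have "represents (length us) \<pi>s"
    by simp
  then show ?case
    by (rule exI[where x = \<pi>s, OF conjI]) (unfold unfold_call, simp)
next
  case (Suc r)
  then have i: "i < length us" and rep: "represents i \<pi>s"
    by auto
  let ?n = "length us" and ?k = "length ss" and ?m = "length cs" and ?M = table_bound
  let ?c = "candidates i \<pi>s" and ?d = "Suc i * length ss"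
  obtain \<pi>s' where \<pi>s': "represents ?n \<pi>s'"
    and IH: "computes_within P (ix Loop)
     (Node I (Node (num_tree r) (Node (num_tree (Suc i))
        (Node (num_tree ?d) (list_tree (map pt (step i \<pi>s)))))))
     (list_tree (map pt \<pi>s')) (r * (level_cost B ?n ?k ?m * ?M) + 20)"
    using Suc.IH[OF represents_step[OF rep i]] Suc.prems(2) by auto
  \<comment> \<open>Unary addition: prepending \<open>k\<close> leaves advances the depth from
    \<open>i * k\<close> to \<open>Suc i * k\<close>.\<close>
  have app: "computes_within P (ix Append) (Node (num_tree ?k) (num_tree (i * ?k))) (num_tree ?d)
      (20 * (?k + 1))"
    using computes_append[of "replicate ?k Leaf" "replicate (i * ?k) Leaf"]
    by (simp add: num_tree_def replicate_add)
  note pre = computes_prefix[of ?n "Suc i", folded set_tree_take[OF distinct_us]]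
  have sum: "(\<Sum>\<pi>\<leftarrow>\<pi>s. 2 ^ card (set ss - tasks \<pi>)) \<le> ?M"
    using sum_free_tasks_width[OF rep] i by simp
  have M: "1 \<le> ?M"
    by simp
  have "(200 * (?k + 1) + 2 * check_cost B ?k ?m + 200) *
        ((\<Sum>\<pi>\<leftarrow>\<pi>s. 2 ^ card (set ss - tasks \<pi>)) + 1)
      \<le> (200 * (?k + 1) + 2 * check_cost B ?k ?m + 200) * (2 * ?M)"
    by (rule mult_le_mono2) (use sum M in linarith)
  note cand = computes_within_mono[OF computes_candidates_plans[OF rep i] this]
  have "length ?c \<le> ?M"
    using sum length_candidates_le[of i \<pi>s] unfolding length_extensions_concat by linarith
  moreover have "?d \<le> ?n * ?k"
    using i by (intro mult_le_mono1) simp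
  \<comment> \<open>Only the list length is charged to the table size; the depth factor is bounded
    by \<open>n * k + 1\<close> and joins the polynomial.\<close>
  ultimately have "(4 * le_cost B ?k + 500) * (?d + 1) * min (2 ^ ?d) (length ?c) + 10
      \<le> (4 * le_cost B ?k + 500) * (?n * ?k + 1) * ?M + 10"
    using i by (intro add_mono mult_mono) auto
  then have sort: "computes_within P (ix Sort) (Node D (Node (num_tree ?d) (list_tree (map pt ?c))))
     (Node (list_tree (map pt (step i \<pi>s))) (list_tree (map pt (drop (2 ^ ?d) ?c))))
     ((4 * le_cost B ?k + 500) * (?n * ?k + 1) * ?M + 10)"
    unfolding step_def
    by (rule computes_within_mono[OF computes_sort[where A = "plans_on (U (Suc i))"], rotated 2])
      (fact computes_le set_candidates)+
  have bound: "20 * (?k + 1) + 30 * (?n + 1) +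
      (200 * (?k + 1) + 2 * check_cost B ?k ?m + 200) * (2 * ?M) +
      ((4 * le_cost B ?k + 500) * (?n * ?k + 1) * ?M + 10) + 200 \<le> level_cost B ?n ?k ?m * ?M"
  proof -
    have "(20 * (?k + 1) + 30 * (?n + 1) + 210) * 1 \<le> (20 * (?k + 1) + 30 * (?n + 1) + 300) * ?M"
      by (rule mult_le_mono[OF _ M]) simp
    then show ?thesis
      unfolding level_cost_def by (simp add: algebra_simps del: max.bounded_iff)
  qed
  have "computes_within P (ix Loop)
     (Node I (Node (num_tree (Suc r)) (Node (num_tree i)
        (Node (num_tree (i * length ss)) (list_tree (map pt \<pi>s))))))
     (list_tree (map pt \<pi>s')) (Suc r * (level_cost B ?n ?k ?m * ?M) + 20)"
    unfolding unfold_call instance_tree_def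
    using computes_withinD[OF IH[unfolded instance_tree_def]] computes_withinD[OF app]
      computes_withinD[OF pre] computes_withinD[OF cand[unfolded instance_tree_def]]
      computes_withinD[OF sort] bound
    by simp
  with \<pi>s' show ?case by blast
qed

lemma computes_main:
  "\<exists>v. wsp_answer ss us A (set cs) v \<and> computes_within P (ix Main) I v
     (solve_cost B (length us) (length ss) (length cs) * table_bound)"
proof -
  let ?n = "length us" and ?k = "length ss" and ?m = "length cs" and ?M = table_bound
  let ?e = "({}, Map.empty) :: ('s, 'u) plan"
  obtain \<pi>s where rep: "represents ?n \<pi>s"
    and loop: "computes_within P (ix Loop)
     (Node I (Node (num_tree ?n) (Node Leaf
        (Node Leaf (list_tree (map pt (filter valid_plan [?e])))))))
     (list_tree (map pt \<pi>s)) (?n * (level_cost B ?n ?k ?m * ?M) + 20)"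
    using computes_loop[OF represents_0, of ?n] by auto
  note pre = computes_prefix[of ?n 0, folded set_tree_take[OF distinct_us]]
  \<comment> \<open>A row without assignments is the numeral of \<open>k\<close>, so the initial row
    can be taken straight from the instance tree.\<close>
  have row: "row us ss Map.empty = num_tree ?k"
    by (simp add: row_def num_tree_def map_replicate_const)
  have "is_plan (set ss) (set us) ?e"
    by (simp add: is_plan_def)
  note check = computes_check[OF this]
  have "computes_within P (ix Filter_Valid)
     (Node (Node I (set_tree us {})) (Node (list_tree (map (row us ss) [Map.empty])) (list_tree [])))
     (list_tree (map (\<lambda>g. Node (set_tree us {}) (row us ss g))
        (filter (\<lambda>g. valid_plan ({}, g)) [Map.empty]) @ []))
     ((check_cost B ?k ?m + 60) * (length [Map.empty :: 's \<rightharpoonup> 'u] + 1))"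
    by (rule computes_filter_valid) (use check in \<open>simp add: plan_tree_row\<close>)
  then have filt: "computes_within P (ix Filter_Valid)
     (Node (Node I (set_tree us {})) (Node (Node (num_tree ?k) Leaf) Leaf))
     (list_tree (map pt (filter valid_plan [?e]))) (2 * check_cost B ?k ?m + 120)"
    by (cases "valid_plan ?e") (simp_all add: row plan_tree_row)
  define v where "v = (case find (\<lambda>\<pi>. set ss \<subseteq> dom (snd \<pi>)) \<pi>s of None \<Rightarrow> Leaf
      | Some \<pi> \<Rightarrow> Node Leaf (pt \<pi>))"
  have "length \<pi>s = (\<Sum>\<pi>\<leftarrow>\<pi>s. 1)"
    by (simp add: sum_list_triv)
  also have "\<dots> \<le> (\<Sum>\<pi>\<leftarrow>\<pi>s. 2 ^ card (set ss - tasks \<pi>))"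
    by (intro sum_list_mono) simp
  also have "\<dots> \<le> ?M"
    using sum_free_tasks_width[OF rep] by simp
  finally have "60 * (?k + 1) * (length \<pi>s + 1) \<le> 60 * (?k + 1) * (?M + 1)"
    by (intro mult_le_mono2) simp
  then have find: "computes_within P (ix Find) (list_tree (map pt \<pi>s)) v (60 * (?k + 1) * (?M + 1))"
    using computes_within_mono[OF computes_find[of "\<lambda>\<pi>. set_tree us (users \<pi>)" us ss \<pi>s]]
    unfolding v_def plan_tree_fun by blast
  have M: "1 \<le> ?M"
    by simp
  have bound: "30 * (?n + 1) + (2 * check_cost B ?k ?m + 120) +
      (?n * (level_cost B ?n ?k ?m * ?M) + 20) + 60 * (?k + 1) * (?M + 1) + 100
      \<le> solve_cost B ?n ?k ?m * ?M"
  proof -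
    have "(30 * (?n + 1) + 2 * check_cost B ?k ?m + 240 + 60 * (?k + 1)) * 1 \<le>
        (30 * (?n + 1) + 2 * check_cost B ?k ?m + 500 + 60 * (?k + 1)) * ?M"
      by (rule mult_le_mono[OF _ M]) simp
    then show ?thesis
      unfolding solve_cost_def by (simp add: algebra_simps del: max.bounded_iff)
  qed
  have "computes_within P (ix Main) I v (solve_cost B ?n ?k ?m * ?M)"
    unfolding unfold_call instance_tree_def
    using computes_withinD[OF loop[unfolded instance_tree_def]] computes_withinD[OF pre]
      computes_withinD[OF filt[unfolded instance_tree_def]] computes_withinD[OF find] bound
    by simp
  moreover have "wsp_answer ss us A (set cs) v"
  proof (cases "find (\<lambda>\<pi>. set ss \<subseteq> dom (snd \<pi>)) \<pi>s")
    case None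
    \<comment> \<open>A complete valid plan has the last user set, so the table holds an equivalent
      one. Equivalent plans share their task set, hence the search would have succeeded.\<close>
    have "\<not> (complete_plan (set ss) (set us) \<pi> \<and> valid_plan \<pi>)" for \<pi>
    proof
      assume \<pi>: "complete_plan (set ss) (set us) \<pi> \<and> valid_plan \<pi>"
      then have "users \<pi> = U ?n"
        by (simp add: complete_plan_def)
      with \<pi> obtain \<pi>' where \<pi>': "\<pi>' \<in> set \<pi>s" "(\<pi>, \<pi>') \<in> R"
        using rep unfolding represents_def by blast
      have "set ss \<subseteq> tasks \<pi>'"
        using related_plansD(4)[OF \<pi>'(2)] \<pi> by (simp add: complete_plan_def)
      with None \<pi>'(1) show False
        unfolding find_None_iff by blast
    qed
    then show ?thesis
      using None by (simp add: wsp_answer_def v_def)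
  next
    case (Some \<pi>)
    then have \<pi>: "\<pi> \<in> set \<pi>s" "set ss \<subseteq> tasks \<pi>"
      by (auto simp: find_Some_iff)
    then have valid: "valid_plan \<pi>" and users: "users \<pi> = set us"
      using rep by (auto simp: represents_def)
    have complete: "complete_plan (set ss) (set us) \<pi>"
      using valid users \<pi>(2) by (auto simp: complete_plan_def valid_def eligible_def is_plan_def)
    have "v = Node Leaf (pt \<pi>)"
      using Some by (simp add: v_def)
    with complete valid show ?thesis
      unfolding wsp_answer_def by metis
  qed
  ultimately show ?thesis by blast
qed

end

lemma polynomial3_solve_cost:
  assumes "polynomial3 p"
  shows "polynomial3 (\<lambda>n k m. solve_cost (p n k m) n k m)"
  unfolding solve_cost_def level_cost_def check_cost_def le_cost_def
  by (intro polynomial3.intros assms)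

text \<open>Solver and polynomial are chosen before the instance, its description and its encoding,
  so a single program serves all of them. Taking \<open>max 2 w\<close> keeps the logarithm from
  vanishing for small widths.\<close>

theorem theorem14:
  fixes Lib :: program and fa fc fe fo :: nat and p :: "nat \<Rightarrow> nat \<Rightarrow> nat \<Rightarrow> nat"
  assumes "polynomial3 p"
  shows "\<exists>(Solver :: program) (main :: nat) q. polynomial3 q \<and>
    (\<forall>(S :: 's set) (U :: 'u set) A C ss us cs D R w n k m.
       wsp_instance S U A C \<and> n = card U \<and> k = card S \<and> m = card C \<and>
       enumerates ss S \<and> enumerates us U \<and> enumerates cs C \<and>
       checkable_within Lib fa fc (p n k m) D ss us cs A \<and>
       plan_indistinguishability S U C R \<and> width S us C R = w \<and>
       (\<exists>enc. encoding_within Lib fe fo (p n k m) D ss us C R enc) \<longrightarrow>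
       (\<exists>v t. runs Solver main (instance_tree D ss us cs) v t \<and> wsp_answer ss us A C v \<and>
          real t \<le> real (q n k m) *
            (3 ^ k * real (max 2 w) * log 2 (real (max 2 w)))))"
proof -
  define ix where "ix r = length Lib + position r" for r
  define Q where "Q = map (body ix fa fc fe fo) routines"
  interpret solver "Lib @ Q" ix fa fc fe fo
    by unfold_locales (simp_all add: ix_def Q_def nth_routines nth_append)
  show ?thesis
  proof (rule exI[of _ "Lib @ Q"], rule exI[of _ "ix Main"],
      rule exI[of _ "\<lambda>n k m. solve_cost (p n k m) n k m"], intro conjI allI impI)
    show "polynomial3 (\<lambda>n k m. solve_cost (p n k m) n k m)"
      by (rule polynomial3_solve_cost[OF assms])
    fix S :: "'s set" and U :: "'u set" and A C ss us cs D R w n k m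
    assume *: "wsp_instance S U A C \<and> n = card U \<and> k = card S \<and> m = card C \<and>
       enumerates ss S \<and> enumerates us U \<and> enumerates cs C \<and>
       checkable_within Lib fa fc (p n k m) D ss us cs A \<and>
       plan_indistinguishability S U C R \<and> width S us C R = w \<and>
       (\<exists>enc. encoding_within Lib fe fo (p n k m) D ss us C R enc)"
    then obtain enc where enc: "encoding_within Lib fe fo (p n k m) D ss us C R enc"
      by blast
    have sets: "S = set ss" "U = set us" "C = set cs" and d: "distinct ss" "distinct us"
      and lens: "n = length us" "k = length ss" "m = length cs"
      using * by (auto simp: enumerates_def distinct_card)
    have chk: "checkable_within (Lib @ Q) fa fc (p n k m) D ss us cs A"
      using * computes_within_append unfolding checkable_within_def by blast
    have enc': "encoding_within (Lib @ Q) fe fo (p n k m) D ss us C R enc"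
      using enc computes_within_append unfolding encoding_within_def Let_def by meson
    interpret wsp_solver "Lib @ Q" ix fa fc fe fo ss us cs A R D enc "p n k m"
      by unfold_locales (use d chk enc' * sets in auto)
    obtain v t where v: "wsp_answer ss us A (set cs) v"
      and t: "runs (Lib @ Q) (ix Main) (instance_tree D ss us cs) v t"
        "t \<le> solve_cost (p n k m) n k m * (max 2 w * 3 ^ k)"
      using computes_main * unfolding computes_within_def sets lens by blast
    \<comment> \<open>The run is already bounded by a polynomial times
      \<open>3 ^ k * max 2 w\<close>; the logarithm only enlarges this.\<close>
    have "1 \<le> log 2 (real (max 2 w))"
      by (simp add: le_log_iff)
    have "real t \<le> real (solve_cost (p n k m) n k m * (max 2 w * 3 ^ k))"
      using t(2) by (rule of_nat_mono)
    also have "\<dots> = real (solve_cost (p n k m) n k m) * (3 ^ k * real (max 2 w) * 1)"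
      by simp
    also have "\<dots> \<le> real (solve_cost (p n k m) n k m) *
        (3 ^ k * real (max 2 w) * log 2 (real (max 2 w)))"
      using \<open>1 \<le> log 2 (real (max 2 w))\<close> by (intro mult_left_mono) auto
    finally show "\<exists>v t. runs (Lib @ Q) (ix Main) (instance_tree D ss us cs) v t \<and>
        wsp_answer ss us A C v \<and> real t \<le> real (solve_cost (p n k m) n k m) *
          (3 ^ k * real (max 2 w) * log 2 (real (max 2 w)))"
      using t(1) v sets by blast
  qed
qed

end
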